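(* Let $q$ be a prime power, $m\ge 2$ an integer and $n=q^m-1$. Consider a primitive, narrow-sense BCH code of length $n$ over $\mathbf{F}_q$ with designed distance $\delta$ in the range $$2\le\delta\le q^{\lceil m/2\rceil}-1-(q-2)[m\text{ is odd}].$$ If $T$ is a subset of $N\setminus\big(\bigcup_{a=1}^{\delta-1}(C_a\cup C_{-a})\big)$ that is a union of cyclotomic cosets and $r=|T\cup T^{-1}|$ with $0\le r<n-2k$, where $k=m\lceil(\delta-1)(1-1/q)\rceil$, then there exists an $$[[q^m-1,\;q^m-1-2m\lceil(\delta-1)(1-1/q)\rceil-r,\;r,\;\ge\delta]]_q$$ subsystem code.
   Context: $[P]$ is $1$ if $P$ is true and $0$ otherwise. $N=\{0,\dots,n-1\}$; $C_x=\{xq^i\bmod n: i\ge 0\}$ is the cyclotomic coset of $x$ modulo $n$; $T^{-1}=\{-t\bmod n: t\in T\}$. The primitive, narrow-sense BCH code of length $n=q^m-1$ over $\mathbf{F}_q$ with designed distance $\delta$ is the cyclic code whose generator polynomial is $\prod_{t\in Z}(x-\alpha^t)$ with defining set $Z=\bigcup_{a=1}^{\delta-1}C_a$, where $\alpha$ is a primitive $n$-th root of unity over $\mathbf{F}_q$. Subsystem codes: let $p$ be the characteristic of $\mathbf{F}_q$. For $(x|y)\in\mathbf{F}_q^{2n}$ (with $x,y\in\mathbf{F}_q^n$), $\mathrm{swt}(x|y)$ is the number of $i$ with $(x_i,y_i)\ne(0,0)$, and $\mathrm{swt}(S)$ is the minimum of $\mathrm{swt}$ over the nonzero elements of $S$.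 The trace-symplectic product of $(a|b)$ and $(a'|b')$ is $\mathrm{tr}_{q/p}(a'\cdot b-a\cdot b')$, and $X^{\perp_s}$ is the dual of $X\subseteq\mathbf{F}_q^{2n}$ with respect to it. All subsystem codes are Clifford subsystem codes: an $((n,K,R,d))_q$ subsystem code is a subspace $Q=A\otimes B$ of $\mathbf{C}^{q^n}$, $\dim A=K$, $\dim B=R$, arising from an additive code; concretely, its existence means that there is an additive subgroup $X\le\mathbf{F}_q^{2n}$ (the zero code is allowed) with $Y=X\cap X^{\perp_s}$ such that $|X|=q^nR/K$, $|Y|=q^n/(KR)$, and $d=\mathrm{swt}(Y^{\perp_s}\setminus X)$ if $Y^{\perp_s}\ne X$, while $d=\mathrm{swt}(Y^{\perp_s})$ if $Y^{\perp_s}=X$ (the case $K=1$). $[[n,k,r,d]]_q$ means $((n,q^k,q^r,d))_q$; writing $\ge\delta$ in the last position means that the minimum distance is some $d\ge\delta$. *)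

theory Defs
  imports
    "HOL-Library.Cardinality"
    "HOL-Algebra.Algebraic_Closure_Type"
    "Jordan_Normal_Form.Matrix"
begin

section \<open>Cyclotomic cosets and BCH codes\<close>

text \<open>Residues modulo \<open>n\<close> are the integers \<open>0, \<dots>, n - 1\<close>; the representative \<open>x\<close> of a coset
  may be any integer, so that \<open>C\<^sub>-\<^sub>a\<close> is \<open>cyclotomic_coset q n (- a)\<close>.\<close>

definition cyclotomic_coset :: "nat \<Rightarrow> nat \<Rightarrow> int \<Rightarrow> int set" where
  "cyclotomic_coset q n x = {(x * int q ^ i) mod int n | i. True}"

definition neg_residues :: "nat \<Rightarrow> int set \<Rightarrow> int set" where
  "neg_residues n T = {(- t) mod int n | t. t \<in> T}"

definition is_union_of_cosets :: "nat \<Rightarrow> nat \<Rightarrow> int set \<Rightarrow> bool" where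
  "is_union_of_cosets q n T \<longleftrightarrow> (\<exists>S \<subseteq> {0..<int n}. T = (\<Union>x\<in>S. cyclotomic_coset q n x))"

definition bch_defining_set :: "nat \<Rightarrow> nat \<Rightarrow> nat \<Rightarrow> int set" where
  "bch_defining_set q n \<delta> = (\<Union>a\<in>{1..int \<delta> - 1}. cyclotomic_coset q n a)"

definition primitive_root_of_unity :: "nat \<Rightarrow> 'b::field \<Rightarrow> bool" where
  "primitive_root_of_unity n \<alpha> \<longleftrightarrow> \<alpha> ^ n = 1 \<and> (\<forall>i. 0 < i \<and> i < n \<longrightarrow> \<alpha> ^ i \<noteq> 1)"

text \<open>A vector \<open>(c\<^sub>0, \<dots>, c\<^sub>n\<^sub>-\<^sub>1)\<close> is identified with the polynomial \<open>c\<^sub>0 + \<dots> + c\<^sub>n\<^sub>-\<^sub>1 x\<^sup>n\<^sup>-\<^sup>1\<close>.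
  Only generator polynomials \<open>g\<close> dividing \<open>x\<^sup>n - 1\<close> are used, and for these the ideal
  generated by \<open>g\<close> modulo \<open>x\<^sup>n - 1\<close> consists of the multiples of \<open>g\<close> of degree below \<open>n\<close>.\<close>

definition cyclic_code :: "nat \<Rightarrow> 'a::field poly \<Rightarrow> 'a vec set" where
  "cyclic_code n g = {c \<in> carrier_vec n. g dvd Poly (list_of_vec c)}"

text \<open>The root of unity lives in the algebraic closure of \<open>F\<^sub>q\<close>, but the generator polynomial
  \<open>g\<close> has coefficients in \<open>F\<^sub>q\<close>; \<open>to_ac\<close> is the embedding of \<open>F\<^sub>q\<close>.\<close>

definition primitive_narrow_sense_bch_code ::
    "nat \<Rightarrow> nat \<Rightarrow> 'a::finite_field vec set \<Rightarrow> bool" where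
  "primitive_narrow_sense_bch_code m \<delta> C \<longleftrightarrow>
     (let q = CARD('a); n = q ^ m - 1 in
      \<exists>(\<alpha> :: 'a alg_closure) (g :: 'a poly).
        primitive_root_of_unity n \<alpha> \<and>
        map_poly to_ac g = (\<Prod>t\<in>bch_defining_set q n \<delta>. [:- (\<alpha> ^ nat t), 1:]) \<and>
        C = cyclic_code n g)"


section \<open>Subsystem codes\<close>

text \<open>The trace from \<open>F\<^sub>q\<close> to its prime field (regarded as a subset of \<open>F\<^sub>q\<close>), for
  \<open>q = p\<^sup>e\<close>: the exponent \<open>e\<close> is the multiplicity of \<open>p\<close> in \<open>q\<close>.\<close>

definition absolute_trace :: "'a::finite_field \<Rightarrow> 'a" where
  "absolute_trace x = (\<Sum>i<multiplicity CHAR('a) CARD('a). x ^ (CHAR('a) ^ i))"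

fun trace_symplectic_product ::
    "'a::finite_field vec \<times> 'a vec \<Rightarrow> 'a vec \<times> 'a vec \<Rightarrow> 'a" where
  "trace_symplectic_product (a, b) (a', b') = absolute_trace (a' \<bullet> b - a \<bullet> b')"

definition trace_symplectic_dual ::
    "nat \<Rightarrow> ('a::finite_field vec \<times> 'a vec) set \<Rightarrow> ('a vec \<times> 'a vec) set" where
  "trace_symplectic_dual n S =
     {v \<in> carrier_vec n \<times> carrier_vec n. \<forall>u\<in>S. trace_symplectic_product u v = 0}"

fun swt :: "'a::zero vec \<times> 'a vec \<Rightarrow> nat" where
  "swt (x, y) = card {i. i < dim_vec x \<and> (x $ i, y $ i) \<noteq> (0, 0)}"

definition swt_set :: "nat \<Rightarrow> ('a::zero vec \<times> 'a vec) set \<Rightarrow> nat" where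
  "swt_set n S = Min (swt ` (S - {(0\<^sub>v n, 0\<^sub>v n)}))"

text \<open>Existence of an \<open>((n, K, R, d))\<^sub>q\<close> (Clifford) subsystem code, where \<open>q\<close> is the cardinality
  of the field. Since \<open>S \<subseteq> Y\<^sup>\<bottom>\<close> and \<open>0 \<in> S\<close>, the minimum defining \<open>d\<close> is taken over a
  nonempty set whenever \<open>n > 0\<close>.\<close>

definition subsystem_code_exists ::
    "'a::finite_field itself \<Rightarrow> nat \<Rightarrow> nat \<Rightarrow> nat \<Rightarrow> nat \<Rightarrow> bool" where
  "subsystem_code_exists _ n K R d \<longleftrightarrow>
     (\<exists>S :: ('a vec \<times> 'a vec) set.
        subgroup S (monoid_vec TYPE('a) n \<times>\<times> monoid_vec TYPE('a) n) \<and>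
        (let q = real CARD('a);
             Y = S \<inter> trace_symplectic_dual n S;
             Yd = trace_symplectic_dual n Y
         in real (card S) = q ^ n * real R / real K \<and>
            real (card Y) = q ^ n / (real K * real R) \<and>
            d = (if Yd \<noteq> S then swt_set n (Yd - S) else swt_set n Yd)))"

text \<open>Existence of an \<open>[[n, k, r, \<ge> \<delta>]]\<^sub>q\<close> subsystem code.\<close>

definition subsystem_code_min_dist_ge_exists ::
    "'a::finite_field itself \<Rightarrow> nat \<Rightarrow> nat \<Rightarrow> nat \<Rightarrow> nat \<Rightarrow> bool" where
  "subsystem_code_min_dist_ge_exists F n k r \<delta> \<longleftrightarrow>
     (\<exists>d\<ge>\<delta>. subsystem_code_exists F n (CARD('a) ^ k) (CARD('a) ^ r) d)"

end

theory Submission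
  imports
    Defs
    "HOL-Number_Theory.Cong"
    "HOL-Algebra.Sylow"
    "Jordan_Normal_Form.Char_Poly"
begin

text \<open>Write \<open>code A\<close> for the cyclic code with defining set \<open>A \<subseteq> N\<close>, let \<open>Z\<close> be the defining set of
  the BCH code and \<open>U = T \<union> T\<^sup>-\<^sup>1\<close>. The range of \<open>\<delta>\<close> makes \<open>Z\<close> a disjoint union of cosets of full
  size \<open>m\<close> and makes \<open>Z\<close> disjoint from \<open>Z\<^sup>-\<^sup>1\<close>. Put \<open>A = N - (Z\<^sup>-\<^sup>1 \<union> U)\<close> and \<open>X = code A \<times> code A\<close>.
  The dual of \<open>code A\<close> is \<open>code (Z \<union> U)\<close>, so \<open>Y = D \<times> D\<close> for \<open>D = code (N - Z\<^sup>-\<^sup>1)\<close>,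
  whose dual is the BCH code \<open>code Z\<close>. Hence the BCH bound controls the distance, and
  \<open>|code A| = q\<^sup>k\<^sup>+\<^sup>r\<close> and \<open>|D| = q\<^sup>k\<close> give the parameters.\<close>

no_notation fps_nth (infixl \<open>$\<close> 75)


section \<open>Cyclotomic cosets and defining sets\<close>

text \<open>Arithmetic modulo \<open>n\<close> only; the field and the root of unity enter later, in
  \<open>bch_root\<close>.\<close>

locale q_modulus =
  fixes q m n :: nat
  assumes q_ge_2: "2 \<le> q" and m_ge_2: "2 \<le> m" and n_eq: "n = q ^ m - 1"
begin

lemma q_power_m: "q ^ m = n + 1"
  using q_ge_2 n_eq by simp

lemma n_ge_3: "3 \<le> n"
proof -
  have "2 ^ 2 \<le> (2::nat) ^ m" using m_ge_2 by (intro power_increasing) auto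
  also have "\<dots> \<le> q ^ m" using q_ge_2 by (rule power_mono) simp
  finally show ?thesis using n_eq by simp
qed

lemma n_pos [simp]: "0 < n"
  using n_ge_3 by simp

lemma cong_mult_q_power_m: "[x * int q ^ m = x] (mod int n)"
proof -
  have "int q ^ m = int n + 1" using q_power_m by (metis of_nat_1 of_nat_add of_nat_power)
  then have "x * int q ^ m = x + int n * x" by (simp add: algebra_simps)
  then show ?thesis by (simp add: cong_def)
qed

text \<open>Since q^m is 1 modulo \<open>n\<close>, the factor q^(m-l) undoes q^l, so either side of
  such a congruence can be made to carry the power of \<open>q\<close>.\<close>

lemma cong_q_power_swap:
  assumes "[a = b * int q ^ l] (mod int n)" and "l \<le> m"
  shows "[b = a * int q ^ (m - l)] (mod int n)"
proof -
  have "[a * int q ^ (m - l) = b * int q ^ l * int q ^ (m - l)] (mod int n)"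
    by (intro cong_mult assms cong_refl)
  moreover have "b * int q ^ l * int q ^ (m - l) = b * int q ^ m"
    using assms(2) by (simp add: mult.assoc flip: power_add)
  ultimately show ?thesis
    using cong_mult_q_power_m[of b] by (metis cong_sym cong_trans)
qed

lemma cong_q_power_mod: "[x * int q ^ i = x * int q ^ (i mod m)] (mod int n)"
proof -
  have "[x * int q ^ (j * m) = x] (mod int n)" for x j
  proof (induction j)
    case (Suc j)
    have "x * int q ^ (Suc j * m) = x * int q ^ (j * m) * int q ^ m"
      by (simp add: power_add mult_ac)
    then show ?case using Suc cong_mult_q_power_m by (metis cong_trans)
  qed simp
  from this[of "x * int q ^ (i mod m)" "i div m"] show ?thesis
    by (simp add: mult.assoc flip: power_add)
qed

text \<open>Equivalently, a union of cyclotomic cosets. Asking for a single factor \<open>q\<close>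
  makes closure under unions and negation immediate; higher powers follow in
  \<open>frob_closed_power\<close>.\<close>

definition frob_closed :: "int set \<Rightarrow> bool" where
  "frob_closed A \<longleftrightarrow> A \<subseteq> {0..<int n} \<and> (\<forall>t\<in>A. t * int q mod int n \<in> A)"

lemma frob_closed_subset: "frob_closed A \<Longrightarrow> A \<subseteq> {0..<int n}"
  by (simp add: frob_closed_def)

lemma frob_closed_finite: "frob_closed A \<Longrightarrow> finite A"
  using frob_closed_subset finite_subset by blast

lemma frob_closed_power:
  assumes "frob_closed A" "t \<in> A"
  shows "t * int q ^ i mod int n \<in> A"
proof (induction i)
  case 0
  then show ?case using assms by (force simp: frob_closed_def)
next
  case (Suc i)
  then have "(t * int q ^ i mod int n) * int q mod int n \<in> A"
    using assms by (auto simp: frob_closed_def)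
  then show ?case by (simp add: mod_mult_left_eq mod_mult_right_eq mult_ac)
qed

lemma frob_closed_Un: "frob_closed A \<Longrightarrow> frob_closed B \<Longrightarrow> frob_closed (A \<union> B)"
  by (auto simp: frob_closed_def)

lemma frob_closed_UN: "(\<And>x. x \<in> I \<Longrightarrow> frob_closed (A x)) \<Longrightarrow> frob_closed (\<Union>x\<in>I. A x)"
  by (fastforce simp: frob_closed_def)

text \<open>Multiplication by \<open>q\<close> is invertible modulo \<open>n\<close>, with inverse
  q^(m-1): if it moved \<open>t\<close> into \<open>A\<close>, then \<open>t\<close> would already
  lie in \<open>A\<close>.\<close>

lemma frob_closed_complement:
  assumes "frob_closed A"
  shows "frob_closed ({0..<int n} - A)"
  unfolding frob_closed_def
proof (intro conjI ballI)
  fix t assume t: "t \<in> {0..<int n} - A"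
  have "t * int q mod int n \<notin> A"
  proof
    assume "t * int q mod int n \<in> A"
    from frob_closed_power[OF assms this, of "m - 1"]
    have "t * int q ^ Suc (m - 1) mod int n \<in> A"
      by (simp add: mod_mult_left_eq mod_mult_right_eq mult_ac)
    then show False
      using t m_ge_2 cong_mult_q_power_m[of t] by (simp add: cong_def)
  qed
  then show "t * int q mod int n \<in> {0..<int n} - A" by simp
qed auto

lemma frob_closed_cyclotomic_coset: "frob_closed (cyclotomic_coset q n x)"
  unfolding frob_closed_def
proof (intro conjI ballI)
  fix t assume "t \<in> cyclotomic_coset q n x"
  then obtain i where "t = x * int q ^ i mod int n"
    by (auto simp: cyclotomic_coset_def)
  then have "t * int q mod int n = x * int q ^ Suc i mod int n"
    by (simp add: mod_mult_left_eq mod_mult_right_eq mult_ac)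
  then show "t * int q mod int n \<in> cyclotomic_coset q n x"
    by (auto simp: cyclotomic_coset_def intro: exI[of _ "Suc i"])
qed (auto simp: cyclotomic_coset_def)

lemma frob_closed_bch_defining_set: "frob_closed (bch_defining_set q n \<delta>)"
  unfolding bch_defining_set_def by (intro frob_closed_UN frob_closed_cyclotomic_coset)

lemma neg_residues_subset: "neg_residues n A \<subseteq> {0..<int n}"
  by (auto simp: neg_residues_def)

lemma frob_closed_neg_residues:
  assumes "frob_closed A"
  shows "frob_closed (neg_residues n A)"
  unfolding frob_closed_def
proof (intro conjI ballI neg_residues_subset)
  fix s assume "s \<in> neg_residues n A"
  then obtain t where t: "t \<in> A" "s = (- t) mod int n" by (auto simp: neg_residues_def)
  have "s * int q mod int n = - (t * int q mod int n) mod int n"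
    unfolding t by (simp add: mod_mult_left_eq mod_minus_eq)
  then show "s * int q mod int n \<in> neg_residues n A"
    using assms t by (auto simp: neg_residues_def frob_closed_def)
qed

lemma mem_neg_residues_iff:
  assumes "A \<subseteq> {0..<int n}"
  shows "t \<in> neg_residues n A \<longleftrightarrow> t \<in> {0..<int n} \<and> (- t) mod int n \<in> A"
proof
  assume "t \<in> neg_residues n A"
  then obtain s where "s \<in> A" "t = (- s) mod int n" by (auto simp: neg_residues_def)
  then show "t \<in> {0..<int n} \<and> (- t) mod int n \<in> A"
    using assms by (force simp: mod_minus_eq)
next
  assume t: "t \<in> {0..<int n} \<and> (- t) mod int n \<in> A"
  then have "t = (- ((- t) mod int n)) mod int n" by (simp add: mod_minus_eq)
  then show "t \<in> neg_residues n A" using t by (auto simp: neg_residues_def)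
qed

lemma neg_residues_neg_residues:
  assumes "A \<subseteq> {0..<int n}"
  shows "neg_residues n (neg_residues n A) = A"
  using assms
  by (auto simp: mem_neg_residues_iff[OF neg_residues_subset] mem_neg_residues_iff[OF assms]
      mod_minus_eq)

lemma neg_residues_Diff:
  assumes "A \<subseteq> {0..<int n}"
  shows "neg_residues n ({0..<int n} - A) = {0..<int n} - neg_residues n A"
  by (intro Set.set_eqI)
    (auto simp only: Diff_iff mem_neg_residues_iff[OF assms] mem_neg_residues_iff[OF Diff_subset]
      atLeastLessThan_iff pos_mod_sign[of "int n"] pos_mod_bound[of "int n"] of_nat_0_less_iff n_pos)

lemma neg_residues_Un: "neg_residues n (A \<union> B) = neg_residues n A \<union> neg_residues n B"
  by (auto simp: neg_residues_def)

lemma neg_residues_cyclotomic_coset: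
  "neg_residues n (cyclotomic_coset q n x) = cyclotomic_coset q n (- x)"
  unfolding neg_residues_def cyclotomic_coset_def
  by (auto simp: mod_minus_eq) (metis mod_minus_eq)

text \<open>An image is never larger than its source, and negation is an involution, so the
  inequality can be applied in both directions.\<close>

lemma card_neg_residues:
  assumes "A \<subseteq> {0..<int n}"
  shows "card (neg_residues n A) = card A"
proof -
  have le: "card (neg_residues n B) \<le> card B" if "B \<subseteq> {0..<int n}" for B
  proof -
    have "neg_residues n B = (\<lambda>t. (- t) mod int n) ` B" by (auto simp: neg_residues_def)
    then show ?thesis using that by (metis card_image_le finite_atLeastLessThan_int finite_subset)
  qed
  from le[OF assms] le[OF neg_residues_subset, of A] show ?thesis
    by (simp add: neg_residues_neg_residues[OF assms])
qed

text \<open>Multiplying a congruence \<open>a \<equiv> \<plusminus> b q\<^sup>l\<close> by \<open>q\<^sup>m\<^sup>-\<^sup>l\<close> interchanges \<open>a\<close> and \<open>b\<close>, so one may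
  assume \<open>l \<le> m div 2\<close>; then both sides are too small for a wrap-around modulo \<open>n\<close>.\<close>

lemma small_cong_imp_eq:
  fixes a b :: int
  assumes B: "B * (1 + q ^ (m div 2)) < n"
    and ab: "1 \<le> a" "a \<le> int B" "1 \<le> b" "b \<le> int B"
    and ndvd: "\<not> int q dvd a" "\<not> int q dvd b"
    and l: "l < m" and cong: "[a = b * int q ^ l] (mod int n)"
  shows "a = b \<and> l = 0"
proof -
  have small: "x = y \<and> j = 0"
    if "1 \<le> x" "x \<le> int B" "1 \<le> y" "y \<le> int B" "\<not> int q dvd x"
      "j \<le> m div 2" "[x = y * int q ^ j] (mod int n)" for x y j
  proof -
    have "y * int q ^ j \<le> int B * int q ^ (m div 2)"
      using that q_ge_2 by (intro mult_mono power_increasing) auto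
    also have "\<dots> = int (B * q ^ (m div 2))" by simp
    also have "\<dots> < int n" using B by (simp only: of_nat_less_iff) (simp add: algebra_simps)
    finally have "y * int q ^ j < int n" .
    moreover have "x < int n"
      using that B by (auto simp: algebra_simps intro: le_less_trans[of _ "int B"])
    ultimately have "x = y * int q ^ j"
      using that by (intro cong_less_imp_eq_int[where m = "int n"]) auto
    with that(5) show ?thesis by (cases j) auto
  qed
  show ?thesis
  proof (cases "l \<le> m div 2")
    case True
    then show ?thesis using small ab ndvd cong by blast
  next
    case False
    then have "m - l \<le> m div 2" by linarith
    with small[of b a "m - l"] cong_q_power_swap[OF cong] ab ndvd l
    have "m - l = 0" by auto
    with l show ?thesis by simp
  qed
qed

lemma small_not_cong_neg:
  fixes a b :: int
  assumes B: "B * (1 + q ^ (m div 2)) < n"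
    and ab: "1 \<le> a" "a \<le> int B" "1 \<le> b" "b \<le> int B" and l: "l < m"
  shows "\<not> [a = - b * int q ^ l] (mod int n)"
proof
  assume cong: "[a = - b * int q ^ l] (mod int n)"
  have small: False
    if "1 \<le> x" "x \<le> int B" "1 \<le> y" "y \<le> int B"
      "j \<le> m div 2" "[x = - y * int q ^ j] (mod int n)" for x y j
  proof -
    have "y * int q ^ j \<le> int B * int q ^ (m div 2)"
      using that q_ge_2 by (intro mult_mono power_increasing) auto
    then have "x + y * int q ^ j \<le> int (B * (1 + q ^ (m div 2)))"
      using that by (simp add: algebra_simps)
    also have "\<dots> < int n" using B by (simp only: of_nat_less_iff)
    finally have "x + y * int q ^ j < int n" .
    moreover have "0 < x + y * int q ^ j"
      using that by (intro add_pos_nonneg mult_nonneg_nonneg) auto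
    moreover have "int n dvd x + y * int q ^ j"
      using that(6) by (simp add: cong_iff_dvd_diff)
    ultimately show False using zdvd_not_zless by blast
  qed
  show False
  proof (cases "l \<le> m div 2")
    case True
    then show ?thesis using small ab cong by blast
  next
    case False
    then have "m - l \<le> m div 2" by linarith
    moreover have "[b = - a * int q ^ (m - l)] (mod int n)"
      using cong_q_power_swap[OF cong] l cong_minus_minus_iff[of "-b" "a * int q ^ (m - l)" "int n"]
      by simp
    ultimately show False using small[of b a "m - l"] ab by auto
  qed
qed

section \<open>Disjointness and size of the BCH defining set\<close>

lemma bch_defining_set_neg_disjoint:
  assumes "(\<delta> - 1) * (1 + q ^ (m div 2)) < n"
  shows "bch_defining_set q n \<delta> \<inter> neg_residues n (bch_defining_set q n \<delta>) = {}"
proof (rule ccontr)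
  assume "\<not> ?thesis"
  then obtain x where x: "x \<in> bch_defining_set q n \<delta>"
    "x \<in> neg_residues n (bch_defining_set q n \<delta>)" by blast
  from x(1) obtain a i where a: "a \<in> {1..int \<delta> - 1}" "x = a * int q ^ i mod int n"
    by (auto simp: bch_defining_set_def cyclotomic_coset_def)
  from x(2) obtain b j where b: "b \<in> {1..int \<delta> - 1}"
    "x = (- (b * int q ^ j mod int n)) mod int n"
    by (auto simp: bch_defining_set_def neg_residues_def cyclotomic_coset_def)
  have *: "a \<in> {1..int \<delta> - 1}" "b \<in> {1..int \<delta> - 1}"
    "a * int q ^ i mod int n = (- (b * int q ^ j mod int n)) mod int n"
    using a b by auto
  \<comment> \<open>The aim is to solve for \<open>a\<close>: the power of \<open>q\<close> moves to
    the side of \<open>b\<close>, and its exponent is reduced below \<open>m\<close>, as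
    \<open>small_not_cong_neg\<close> requires.\<close>
  define i' where "i' = i mod m"
  have i': "i' \<le> m" using m_ge_2 by (simp add: i'_def less_imp_le)
  have "[- b * int q ^ j = a * int q ^ i] (mod int n)"
    using *(3) by (simp add: cong_def mod_minus_eq)
  then have "[- b * int q ^ j = a * int q ^ i'] (mod int n)"
    unfolding i'_def using cong_q_power_mod cong_trans by blast
  from cong_q_power_swap[OF this i']
  have "[a = - b * int q ^ (j + (m - i'))] (mod int n)"
    by (simp only: power_add mult.assoc)
  then have "[a = - b * int q ^ ((j + (m - i')) mod m)] (mod int n)"
    using cong_q_power_mod cong_trans by blast
  moreover have "(j + (m - i')) mod m < m" using m_ge_2 by simp
  ultimately show False using small_not_cong_neg[OF assms, of a b] * by auto
qed

text \<open>Dividing a representative by powers of \<open>q\<close> stays in its coset and only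
  makes it smaller, so representatives not divisible by \<open>q\<close> suffice.\<close>

lemma bch_defining_set_eq_image:
  "bch_defining_set q n \<delta> =
     (\<lambda>(a, j). a * int q ^ j mod int n) ` ({a \<in> {1..int \<delta> - 1}. \<not> int q dvd a} \<times> {..<m})"
proof -
  have "\<exists>b\<in>{1..int \<delta> - 1}. \<not> int q dvd b \<and> (\<exists>l. a = b * int q ^ l)"
    if a: "a \<in> {1..int \<delta> - 1}" for a
  proof -
    \<comment> \<open>\<open>q\<close> may be composite; \<open>multiplicity\<close> still gives the
      largest power of \<open>q\<close> dividing \<open>a\<close>.\<close>
    define l where "l = multiplicity (int q) a"
    obtain b where b: "a = b * int q ^ l" "\<not> int q dvd b"
      using multiplicity_decompose'[of a "int q"] a q_ge_2
      by (auto simp: l_def mult.commute)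
    have "0 < b * int q ^ l" using a b by simp
    then have "b > 0" using q_ge_2 by (simp add: zero_less_mult_iff)
    moreover have "b \<le> a"
      using b(1) \<open>b > 0\<close> q_ge_2 by (simp add: mult_le_cancel_left1)
    ultimately have "b \<in> {1..int \<delta> - 1}"
      using a unfolding atLeastAtMost_iff by linarith
    then show ?thesis using b by blast
  qed
  note reduce = this
  show ?thesis
  proof (intro equalityI subsetI)
    fix x assume "x \<in> bch_defining_set q n \<delta>"
    then obtain a i where a: "a \<in> {1..int \<delta> - 1}" "x = a * int q ^ i mod int n"
      by (auto simp: bch_defining_set_def cyclotomic_coset_def)
    from reduce[OF a(1)] obtain b l
      where b: "b \<in> {1..int \<delta> - 1}" "\<not> int q dvd b" "a = b * int q ^ l" by blast
    have "x = b * int q ^ (l + i) mod int n"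
      by (simp add: a b power_add mult.assoc)
    also have "\<dots> = b * int q ^ ((l + i) mod m) mod int n"
      using cong_q_power_mod by (simp add: cong_def)
    finally show "x \<in> (\<lambda>(a, j). a * int q ^ j mod int n) `
        ({a \<in> {1..int \<delta> - 1}. \<not> int q dvd a} \<times> {..<m})"
      using b m_ge_2 by (intro image_eqI[where x = "(b, (l + i) mod m)"]) auto
  qed (auto simp: bch_defining_set_def cyclotomic_coset_def)
qed

lemma card_not_multiples:
  "card {a \<in> {1..int \<delta> - 1}. \<not> int q dvd a} = (\<delta> - 1) - (\<delta> - 1) div q"
proof -
  define D where "D = \<delta> - 1"
  have D: "{1..int \<delta> - 1} = {1..int D}" by (auto simp: D_def)
  have mult: "{a \<in> {1..int D}. int q dvd a} = (\<lambda>k. int q * k) ` {1..int (D div q)}"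
  proof (intro equalityI subsetI)
    fix a assume "a \<in> {a \<in> {1..int D}. int q dvd a}"
    then obtain k where k: "a = int q * k" "1 \<le> a" "a \<le> int D" by auto
    have "0 < int q * k" using k by linarith
    then have "0 < k" using q_ge_2 by (simp add: zero_less_mult_iff)
    moreover have "int q * k div int q \<le> int D div int q"
      using k q_ge_2 by (intro zdiv_mono1) auto
    ultimately show "a \<in> (\<lambda>k. int q * k) ` {1..int (D div q)}"
      using k q_ge_2 by (auto simp: zdiv_int)
  next
    fix a assume "a \<in> (\<lambda>k. int q * k) ` {1..int (D div q)}"
    then obtain k where k: "a = int q * k" "1 \<le> k" "k \<le> int (D div q)"
      unfolding image_iff Bex_def atLeastAtMost_iff by blast
    have "int q * k \<le> int q * int (D div q)" using k by (intro mult_left_mono) auto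
    also have "\<dots> \<le> int D" by (metis of_nat_le_iff of_nat_mult times_div_less_eq_dividend)
    finally show "a \<in> {a \<in> {1..int D}. int q dvd a}"
      using k q_ge_2 mult_mono[of 1 "int q" 1 k] by auto
  qed
  have "card {a \<in> {1..int D}. int q dvd a} = D div q"
    unfolding mult using q_ge_2 by (subst card_image) (auto simp: inj_on_def)
  moreover have "{a \<in> {1..int D}. \<not> int q dvd a} = {1..int D} - {a \<in> {1..int D}. int q dvd a}"
    by auto
  moreover have "card ({1..int D} - {a \<in> {1..int D}. int q dvd a}) =
      card {1..int D} - card {a \<in> {1..int D}. int q dvd a}"
    by (rule card_Diff_subset) (auto intro: finite_subset[of _ "{1..int D}"])
  ultimately show ?thesis
    unfolding D D_def[symmetric] by simp
qed

text \<open>By \<open>small_cong_imp_eq\<close> the parametrization of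
  \<open>bch_defining_set_eq_image\<close> is injective: each of these cosets has full size
  \<open>m\<close>, and different representatives not divisible by \<open>q\<close> give disjoint
  cosets.\<close>

lemma card_bch_defining_set:
  assumes "(\<delta> - 1) * (1 + q ^ (m div 2)) < n"
  shows "card (bch_defining_set q n \<delta>) = m * ((\<delta> - 1) - (\<delta> - 1) div q)"
proof -
  let ?A = "{a \<in> {1..int \<delta> - 1}. \<not> int q dvd a}"
  have "inj_on (\<lambda>(a, j). a * int q ^ j mod int n) (?A \<times> {..<m})"
  proof (rule inj_onI, clarify)
    fix a b i j
    assume ab: "a \<in> {1..int \<delta> - 1}" "b \<in> {1..int \<delta> - 1}" "\<not> int q dvd a" "\<not> int q dvd b"
      and ij: "i < m" "j < m" and eq: "a * int q ^ i mod int n = b * int q ^ j mod int n"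
    have "[b * int q ^ j = a * int q ^ i] (mod int n)" using eq by (simp add: cong_def)
    from cong_q_power_swap[OF this] ij
    have "[a = b * int q ^ (j + (m - i))] (mod int n)"
      by (simp only: power_add mult.assoc)
    then have "[a = b * int q ^ ((j + (m - i)) mod m)] (mod int n)"
      using cong_q_power_mod cong_trans by blast
    then have "a = b \<and> (j + (m - i)) mod m = 0"
      using ab m_ge_2 by (intro small_cong_imp_eq[OF assms]) auto
    moreover from this have "i = j"
    proof -
      \<comment> \<open>This multiple of \<open>m\<close> lies strictly between 0 and 2m, hence
        equals \<open>m\<close>.\<close>
      have "m dvd j + (m - i)" using \<open>a = b \<and> (j + (m - i)) mod m = 0\<close> by auto
      then obtain c where c: "j + (m - i) = m * c" by (elim dvdE)
      moreover have "0 < m * c" "m * c < m * 2" unfolding c[symmetric] using ij by linarith+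
      then have "c = 1" by (simp add: mult_less_cancel1)
      ultimately have "j + (m - i) = m" by simp
      then show ?thesis using ij by linarith
    qed
    ultimately show "a = b \<and> i = j" by simp
  qed
  then have "card (bch_defining_set q n \<delta>) = card ?A * m"
    unfolding bch_defining_set_eq_image by (subst card_image) (simp_all add: card_cartesian_product)
  then show ?thesis
    unfolding card_not_multiples by (simp only: mult.commute)
qed

end


section \<open>Finite fields and polynomials\<close>

lemma prime_CHAR_finite_field: "prime CHAR('a::finite_field)"
  using CHAR_pos prime_CHAR_semidom by blast

text \<open>For a prime \<open>r\<close> dividing the order of the additive group there is a
  subgroup of order \<open>r\<close>. A nonzero element of it is annihilated by \<open>r\<close>, so
  the characteristic divides \<open>r\<close> and equals it.\<close>

lemma card_finite_field_power_CHAR: "\<exists>e. CARD('a::finite_field) = CHAR('a) ^ e"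
proof -
  define G where "G = add_monoid (ring_of_type_algebra :: 'a ring)"
  interpret R: field "ring_of_type_algebra :: 'a ring" by (rule field_from_type_algebra)
  have G: "group G" unfolding G_def by (rule R.add.is_group)
  have carrier: "carrier G = UNIV" by (simp add: G_def ring_of_type_algebra_def)
  have pow: "x [^]\<^bsub>G\<^esub> k = of_nat k * x" for x :: 'a and k :: nat
    by (induction k) (simp_all add: G_def ring_of_type_algebra_def nat_pow_def algebra_simps)
  have "r = CHAR('a)" if r: "prime r" "r dvd CARD('a)" for r
  proof -
    \<comment> \<open>Sylow's theorem with exponent 1 is used as Cauchy's theorem; the cofactor may
      still be divisible by \<open>r\<close>.\<close>
    have "CARD('a) = r ^ 1 * (CARD('a) div r)" using r by simp
    then obtain H where H: "subgroup H G" "card H = r ^ 1"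
      using sylow_thm[OF r(1) G, of 1 "CARD('a) div r"] carrier by (auto simp: Coset.order_def)
    interpret H: group "G\<lparr>carrier := H\<rparr>" using G H(1) by (rule subgroup.subgroup_is_group[rotated])
    have "1 < card H" using H(2) r(1) prime_gt_1_nat by simp
    then have "\<not> H \<subseteq> {0}" using card_mono[of "{0}" H] by auto
    then obtain x where x: "x \<in> H" "x \<noteq> 0" by blast
    have "x [^]\<^bsub>G\<^esub> r = \<one>\<^bsub>G\<^esub>"
      using H.pow_order_eq_1[of x] x H(2)
        monoid.nat_pow_consistent[OF group.is_monoid[OF G], of x r H]
      by (simp add: Coset.order_def)
    then have "of_nat r = (0 :: 'a)"
      using x(2) by (simp add: pow) (simp add: G_def ring_of_type_algebra_def)
    then have "CHAR('a) dvd r" by (simp add: of_nat_eq_0_iff_char_dvd)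
    then show ?thesis using r(1) prime_CHAR_finite_field[where 'a = 'a] primes_dvd_imp_eq by blast
  qed
  then have "prime_factors CARD('a) \<subseteq> {CHAR('a)}" by (auto simp: prime_factors_dvd)
  then consider "prime_factors CARD('a) = {}" | "prime_factors CARD('a) = {CHAR('a)}" by blast
  then show ?thesis
  proof cases
    case 1
    then have "CARD('a) = CHAR('a) ^ 0" using prime_factorization_nat[of "CARD('a)"] by simp
    then show ?thesis by blast
  next
    case 2
    then have "CARD('a) = CHAR('a) ^ multiplicity CHAR('a) CARD('a)"
      using prime_factorization_nat[of "CARD('a)"] by simp
    then show ?thesis by blast
  qed
qed

text \<open>The trace polynomial has linear coefficient 1 and degree at most Q^(L-1), so it cannot
  vanish on a larger set. It serves both for the trace down to the prime field and for the trace
  from q^m to \<open>q\<close> elements.\<close>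

lemma trace_polynomial_nonzero:
  fixes S :: "'b::idom set"
  assumes "2 \<le> Q" "0 < L" "finite S" "Q ^ (L - 1) < card S"
  shows "\<exists>x\<in>S. (\<Sum>l<L. x ^ (Q ^ l)) \<noteq> 0"
proof (rule ccontr)
  assume zero: "\<not> ?thesis"
  define P :: "'b poly" where "P = (\<Sum>l<L. monom 1 (Q ^ l))"
  have poly: "poly P x = (\<Sum>l<L. x ^ (Q ^ l))" for x
    by (simp add: P_def poly_sum poly_monom)
  have "coeff P 1 = (\<Sum>l<L. if l = 0 then 1 else 0)"
    unfolding P_def coeff_sum using assms(1) by (intro sum.cong) auto
  then have "P \<noteq> 0" using assms(2) by auto
  moreover have "degree P \<le> Q ^ (L - 1)"
    unfolding P_def using assms(1)
    by (intro degree_sum_le order.trans[OF degree_monom_le] power_increasing) auto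
  moreover have "S \<subseteq> {x. poly P x = 0}" using zero poly by auto
  then have "card S \<le> degree P"
    using card_poly_roots_bound[OF \<open>P \<noteq> 0\<close>] poly_roots_finite[OF \<open>P \<noteq> 0\<close>]
    by (meson card_mono order.trans)
  ultimately show False using assms(4) by linarith
qed

text \<open>The bound is put on coefficients instead of the degree so that the zero polynomial is
  included also for \<open>d = 0\<close>.\<close>

lemma card_polys_below:
  "card {p :: 'a::{finite,comm_monoid_add} poly. \<forall>i\<ge>d. coeff p i = 0} = CARD('a) ^ d \<and>
   finite {p :: 'a poly. \<forall>i\<ge>d. coeff p i = 0}"
proof (induction d)
  case 0
  have "{p :: 'a poly. \<forall>i\<ge>0. coeff p i = 0} = {0}" by (auto simp: poly_eq_iff)
  then show ?case by simp
next
  case (Suc d)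
  let ?P = "\<lambda>d. {p :: 'a poly. \<forall>i\<ge>d. coeff p i = 0}"
  have "?P (Suc d) = (\<lambda>(a, p). pCons a p) ` (UNIV \<times> ?P d)"
  proof (intro equalityI subsetI)
    fix p assume "p \<in> ?P (Suc d)"
    then show "p \<in> (\<lambda>(a, p). pCons a p) ` (UNIV \<times> ?P d)"
      by (cases p) (force simp: coeff_pCons split: nat.splits)
  qed (auto simp: coeff_pCons split: nat.splits)
  moreover have "inj_on (\<lambda>(a, p). pCons a p) (UNIV \<times> ?P d)" by (auto simp: inj_on_def)
  ultimately show ?case
    using Suc by (simp add: card_image card_cartesian_product)
qed

section \<open>Cyclic codes described by the Fourier transform of their words\<close>

locale bch_root =
  fixes \<alpha> :: "'a::finite_field alg_closure" and q m n :: nat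
  assumes q_eq: "q = CARD('a)" and m_ge_2': "2 \<le> m" and n_eq': "n = q ^ m - 1"
    and primitive: "primitive_root_of_unity n \<alpha>"

sublocale bch_root \<subseteq> q_modulus q m n
proof
  have "card {0, 1 :: 'a} \<le> CARD('a)" by (intro card_mono) auto
  then show "2 \<le> q" by (simp add: q_eq)
qed (fact m_ge_2' n_eq')+

context bch_root
begin

lemma alpha_power_n: "\<alpha> ^ n = 1"
  using primitive by (simp add: primitive_root_of_unity_def)

lemma alpha_nonzero [simp]: "\<alpha> \<noteq> 0"
  using alpha_power_n n_ge_3 by (auto simp: power_0_left split: if_splits)

lemma alpha_powi_mod: "\<alpha> powi (i mod int n) = \<alpha> powi i"
proof -
  have "\<alpha> powi (int n * (i div int n) + i mod int n) = \<alpha> powi (i mod int n)"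
    by (subst power_int_add) (simp_all add: power_int_mult alpha_power_n)
  then show ?thesis by simp
qed

lemma alpha_powi_eq_1_iff: "\<alpha> powi i = 1 \<longleftrightarrow> int n dvd i"
proof
  assume "\<alpha> powi i = 1"
  then have "\<alpha> ^ nat (i mod int n) = 1"
    using alpha_powi_mod[of i] by (simp add: power_int_def split: if_splits)
  moreover have "nat (i mod int n) < n" using n_pos by (simp add: nat_less_iff)
  ultimately have "\<not> 0 < nat (i mod int n)"
    using primitive by (auto simp: primitive_root_of_unity_def)
  moreover have "0 \<le> i mod int n" by simp
  ultimately have "i mod int n = 0" by linarith
  then show "int n dvd i" by (rule mod_0_imp_dvd)
next
  assume "int n dvd i"
  then show "\<alpha> powi i = 1" using alpha_powi_mod[of i] by (simp add: dvd_eq_mod_eq_0)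
qed

lemma inj_on_alpha_powi: "inj_on (\<lambda>t. \<alpha> powi t) {0..<int n}"
proof (rule inj_onI)
  fix s t assume st: "s \<in> {0..<int n}" "t \<in> {0..<int n}" "\<alpha> powi s = \<alpha> powi t"
  then have "\<alpha> powi (s - t) = 1" by (simp add: power_int_diff)
  then have "[s = t] (mod int n)" by (simp add: alpha_powi_eq_1_iff cong_iff_dvd_diff)
  then show "s = t" using st by (simp add: cong_def)
qed

text \<open>q^l is a power of the characteristic, so this is the freshman's dream.\<close>

lemma sum_power_q: "(\<Sum>x\<in>A. f x) ^ (q ^ l) = (\<Sum>x\<in>A. f x ^ (q ^ l))"
  for f :: "'c \<Rightarrow> 'a alg_closure"
proof -
  obtain e where "CARD('a) = CHAR('a) ^ e" using card_finite_field_power_CHAR by blast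
  then have "q ^ l = CHAR('a alg_closure) ^ (e * l)" by (simp add: q_eq power_mult)
  then show ?thesis
    by (intro freshmans_dream_sum') (simp_all add: prime_CHAR_finite_field)
qed

lemma to_ac_power_q [simp]: "to_ac (x :: 'a) ^ (q ^ l) = to_ac x"
  using finite_field_power_card_power_eq_same[of "q ^ l" l x]
  by (simp add: q_eq flip: to_ac_power)

text \<open>All \<open>q\<close> embedded field elements are roots of x^q - x, and this polynomial
  has at most \<open>q\<close> roots.\<close>

lemma range_to_ac_iff: "x \<in> range to_ac \<longleftrightarrow> x ^ q = x" for x :: "'a alg_closure"
proof -
  define P :: "'a alg_closure poly" where "P = monom 1 q - monom 1 1"
  have root: "poly P x = 0 \<longleftrightarrow> x ^ q = x" for x by (simp add: P_def poly_monom)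
  have "coeff P q = 1" using q_ge_2 by (simp add: P_def)
  then have "P \<noteq> 0" by auto
  have "degree P \<le> q"
    unfolding P_def using q_ge_2
    by (intro degree_diff_le order.trans[OF degree_monom_le]) auto
  have "range (to_ac :: 'a \<Rightarrow> _) \<subseteq> {x. poly P x = 0}"
    using to_ac_power_q[of _ 1] by (auto simp: root)
  moreover have "card {x. poly P x = 0} \<le> card (range (to_ac :: 'a \<Rightarrow> _))"
    using card_poly_roots_bound[OF \<open>P \<noteq> 0\<close>] \<open>degree P \<le> q\<close>
    by (simp add: card_image inj_to_ac q_eq)
  ultimately have "range (to_ac :: 'a \<Rightarrow> _) = {x. poly P x = 0}"
    by (intro card_seteq poly_roots_finite \<open>P \<noteq> 0\<close>)
  then show ?thesis using root by blast
qed

text \<open>The discrete Fourier transform of \<open>c\<close>, i.e. its polynomial evaluated at the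
  powers of \<alpha>. Integer exponents give direct access to the transform at negatives, which
  duality needs.\<close>

definition spectrum :: "'a vec \<Rightarrow> int \<Rightarrow> 'a alg_closure" where
  "spectrum c t = (\<Sum>i<n. to_ac (c $ i) * \<alpha> powi (t * int i))"

text \<open>Zeros are prescribed directly, without a generator polynomial. The set is arbitrary, so
  that the consecutive exponents in \<open>bch_bound\<close>, which need not be closed under
  multiplication by \<open>q\<close>, also fit.\<close>

definition code :: "int set \<Rightarrow> 'a vec set" where
  "code A = {c \<in> carrier_vec n. \<forall>t\<in>A. spectrum c t = 0}"

lemma spectrum_mod: "spectrum c (t mod int n) = spectrum c t"
proof -
  have "\<alpha> powi (t mod int n * int i) = \<alpha> powi (t * int i)" for i
    by (metis alpha_powi_mod mod_mult_left_eq)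
  then show ?thesis by (simp add: spectrum_def)
qed

lemma code_Int: "code A \<inter> code B = code (A \<union> B)"
  by (auto simp: code_def)

lemma code_mono: "A \<subseteq> B \<Longrightarrow> code B \<subseteq> code A"
  by (auto simp: code_def)

lemma zero_in_code: "0\<^sub>v n \<in> code A"
  by (auto simp: code_def spectrum_def)

lemma add_in_code: "c \<in> code A \<Longrightarrow> d \<in> code A \<Longrightarrow> c + d \<in> code A"
  by (auto simp: code_def spectrum_def algebra_simps sum.distrib)

lemma smult_in_code: "c \<in> code A \<Longrightarrow> a \<cdot>\<^sub>v c \<in> code A"
  by (auto simp: code_def spectrum_def mult.assoc simp flip: sum_distrib_left)

lemma alpha_orthogonality: "(\<Sum>t<n. (\<alpha> powi i) ^ t) = (if int n dvd i then of_nat n else 0)"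
proof (cases "int n dvd i")
  case True
  then have "\<alpha> powi i = 1" by (simp add: alpha_powi_eq_1_iff)
  then show ?thesis using True by simp
next
  case False
  then have "\<alpha> powi i \<noteq> 1" by (simp add: alpha_powi_eq_1_iff)
  moreover have "(\<alpha> powi i) ^ n = 1"
    using alpha_powi_eq_1_iff[of "i * int n"] by (simp add: power_int_mult)
  ultimately show ?thesis using False by (simp add: geometric_sum)
qed

end

lemma poly_eq_sum_lessThan:
  fixes p :: "'b::comm_semiring_1 poly"
  assumes "\<forall>i\<ge>d. coeff p i = 0"
  shows "poly p x = (\<Sum>i<d. coeff p i * x ^ i)"
proof -
  have "poly p x = (\<Sum>i\<le>degree p. coeff p i * x ^ i)" by (rule poly_altdef)
  also have "\<dots> = (\<Sum>i\<in>{..degree p} \<inter> {..<d}. coeff p i * x ^ i)"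
    using assms by (intro sum.mono_neutral_right) (auto simp flip: not_le)
  also have "\<dots> = (\<Sum>i<d. coeff p i * x ^ i)"
    by (intro sum.mono_neutral_left) (auto simp: coeff_eq_0 simp flip: not_less)
  finally show ?thesis .
qed

lemma field_hom_to_ac: "field_hom (to_ac :: 'a::field \<Rightarrow> _)"
  by unfold_locales simp_all

definition euclidean_dual :: "nat \<Rightarrow> 'a::field vec set \<Rightarrow> 'a vec set" where
  "euclidean_dual k C = {d \<in> carrier_vec k. \<forall>c\<in>C. c \<bullet> d = 0}"

section \<open>Generator polynomials and the size of a code\<close>

context bch_root
begin

text \<open>The characteristic divides n + 1 = q^m and therefore not \<open>n\<close>. This permits
  cancelling \<open>n\<close> in the identity of \<open>sum_spectrum_mult\<close>.\<close>

lemma of_nat_n_nonzero: "of_nat n \<noteq> (0 :: 'a alg_closure)"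
proof
  assume "of_nat n = (0 :: 'a alg_closure)"
  moreover obtain e where e: "CARD('a) = CHAR('a) ^ e" using card_finite_field_power_CHAR by blast
  ultimately have "CHAR('a) dvd n" by (simp add: of_nat_eq_0_iff_char_dvd)
  have "e \<noteq> 0" using e q_ge_2 by (cases e) (auto simp: q_eq)
  then have "CHAR('a) dvd q ^ m" using m_ge_2 by (simp add: q_eq e dvd_power flip: power_mult)
  then have "CHAR('a) dvd n + 1" by (simp add: q_power_m)
  then have "CHAR('a) dvd 1" using \<open>CHAR('a) dvd n\<close> by (rule dvd_add_right_iff[THEN iffD1, rotated])
  then show False using prime_CHAR_finite_field[where 'a = 'a] not_prime_unit by blast
qed

text \<open>The map x to x^q permutes the roots, because multiplication by \<open>q\<close> permutes
  \<open>A\<close>. It therefore fixes every coefficient of the product, and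
  \<open>range_to_ac_iff\<close> places the coefficients in the base field.\<close>

lemma generator_exists:
  assumes "frob_closed A"
  shows "\<exists>g :: 'a poly. map_poly to_ac g = (\<Prod>t\<in>A. [:- (\<alpha> powi t), 1:])"
proof -
  define G where "G = (\<Prod>t\<in>A. [:- (\<alpha> powi t), 1:])"
  have add_power_q: "(x + y) ^ q = x ^ q + y ^ q" for x y :: "'a alg_closure"
    \<comment> \<open>Addition of two elements is read as a sum over the two booleans.\<close>
    using sum_power_q[of "\<lambda>b. if b then x else y" UNIV 1] by (simp add: UNIV_bool add.commute)
  interpret frob: comm_ring_hom "\<lambda>x :: 'a alg_closure. x ^ q"
    using q_ge_2 by unfold_locales (simp_all add: power_mult_distrib add_power_q)
  interpret frob_poly: map_poly_comm_ring_hom "\<lambda>x :: 'a alg_closure. x ^ q" ..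
  have inj: "inj_on (\<lambda>t. t * int q mod int n) A"
  proof (rule inj_onI)
    fix s t assume st: "s \<in> A" "t \<in> A" "s * int q mod int n = t * int q mod int n"
    then have "[s * int q = t * int q] (mod int n)" by (simp add: cong_def)
    then have "[s * int q * int q ^ (m - 1) = t * int q * int q ^ (m - 1)] (mod int n)"
      by (rule cong_scalar_right)
    moreover have "x * int q * int q ^ (m - 1) = x * int q ^ m" for x
      using m_ge_2 by (cases m) simp_all
    ultimately have "[s = t] (mod int n)"
      using cong_mult_q_power_m by (metis cong_sym cong_trans)
    then show "s = t" using st frob_closed_subset[OF assms] by (auto simp: cong_def subset_iff)
  qed
  have "(\<lambda>t. t * int q mod int n) ` A \<subseteq> A" using assms by (auto simp: frob_closed_def)
  then have image: "(\<lambda>t. t * int q mod int n) ` A = A"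
    using inj frob_closed_finite[OF assms] by (simp add: endo_inj_surj)
  have "map_poly (\<lambda>x. x ^ q) G = (\<Prod>t\<in>A. map_poly (\<lambda>x. x ^ q) [:- (\<alpha> powi t), 1:])"
    unfolding G_def by (rule frob_poly.hom_prod)
  also have "\<dots> = (\<Prod>t\<in>A. [:- (\<alpha> powi (t * int q mod int n)), 1:])"
    by (intro prod.cong refl)
      (simp add: frob.map_poly_pCons_hom frob.hom_uminus alpha_powi_mod power_int_mult)
  also have "\<dots> = (\<Prod>t\<in>(\<lambda>t. t * int q mod int n) ` A. [:- (\<alpha> powi t), 1:])"
    using inj by (simp add: prod.reindex)
  also have "\<dots> = G" by (simp add: image G_def)
  finally have "coeff G i ^ q = coeff G i" for i by (metis frob.coeff_map_poly_hom)
  then have "coeff G i \<in> range to_ac" for i by (simp add: range_to_ac_iff)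
  then have "map_poly to_ac (map_poly of_ac G) = G"
    by (intro poly_eqI) (simp add: coeff_map_poly to_ac_of_ac)
  then show ?thesis unfolding G_def by blast
qed

lemma spectrum_vec_coeff:
  assumes "\<forall>i\<ge>n. coeff u i = 0"
  shows "spectrum (vec n (coeff u)) t = poly (map_poly to_ac u) (\<alpha> powi t)"
proof -
  have "poly (map_poly to_ac u) (\<alpha> powi t) = (\<Sum>i<n. coeff (map_poly to_ac u) i * (\<alpha> powi t) ^ i)"
    using assms by (intro poly_eq_sum_lessThan) (simp add: coeff_map_poly)
  then show ?thesis by (simp add: spectrum_def coeff_map_poly power_int_mult)
qed

text \<open>Multiplication by the generator polynomial \<open>g\<close>, of degree
  \<open>card A\<close>, is a bijection from the polynomials of degree below
  \<open>n - card A\<close> onto the code.\<close>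

lemma card_code:
  assumes A: "frob_closed A"
  shows "card (code A) = q ^ (n - card A)" and "finite (code A)"
proof -
  define d where "d = n - card A"
  define P where "P = {p :: 'a poly. \<forall>i\<ge>d. coeff p i = 0}"
  interpret to_ac: field_hom "to_ac :: 'a \<Rightarrow> _" by (rule field_hom_to_ac)
  interpret to_ac_poly: map_poly_comm_ring_hom "to_ac :: 'a \<Rightarrow> _" ..
  obtain g :: "'a poly" where g: "map_poly to_ac g = (\<Prod>t\<in>A. [:- (\<alpha> powi t), 1:])"
    using generator_exists[OF A] by blast
  have finA: "finite A" using A by (rule frob_closed_finite)
  have "card A \<le> card {0..<int n}" using frob_closed_subset[OF A] by (intro card_mono) auto
  then have card_A: "card A \<le> n" by simp
  have "map_poly to_ac g \<noteq> 0" unfolding g using finA by simp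
  then have g0: "g \<noteq> 0" by auto
  have "degree (map_poly to_ac g) = (\<Sum>t\<in>A. degree [:- (\<alpha> powi t), 1:])"
    unfolding g by (rule degree_prod_eq_sum_degree) simp
  then have deg_g: "degree g = card A" by simp
  have root_g: "poly (map_poly to_ac g) (\<alpha> powi t) = 0" if "t \<in> A" for t
    using that finA by (auto simp: g poly_prod)
  have bounded: "v \<in> P \<longleftrightarrow> (\<forall>i\<ge>n. coeff (g * v) i = 0)" for v
  proof (cases "v = 0")
    case False
    then have "degree (g * v) = card A + degree v" using g0 deg_g by (simp add: degree_mult_eq)
    moreover have "(\<forall>i\<ge>k. coeff p i = 0) \<longleftrightarrow> degree p < k" if "p \<noteq> 0" for p :: "'a poly" and k
      using that by (metis coeff_eq_0 leading_coeff_neq_0 less_le_trans not_le)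
    ultimately show ?thesis using False g0 card_A by (auto simp: P_def d_def)
  qed (simp add: P_def)
  have "bij_betw (\<lambda>v. vec n (coeff (g * v))) P (code A)"
    unfolding bij_betw_def
  proof (intro conjI inj_onI equalityI subsetI)
    fix v w assume vw: "v \<in> P" "w \<in> P" "vec n (coeff (g * v)) = vec n (coeff (g * w))"
    have "coeff (g * v) i = coeff (g * w) i" for i
    proof (cases "i < n")
      case True
      then show ?thesis using arg_cong[OF vw(3), of "\<lambda>x. x $ i"] by simp
    next
      case False
      then show ?thesis using vw(1,2) bounded by simp
    qed
    then have "g * v = g * w" by (rule poly_eqI)
    then show "v = w" using g0 by simp
  next
    fix c assume "c \<in> (\<lambda>v. vec n (coeff (g * v))) ` P"
    then obtain v where v: "v \<in> P" "c = vec n (coeff (g * v))" by blast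
    show "c \<in> code A"
      unfolding code_def v(2) using v(1) bounded
      by (simp add: spectrum_vec_coeff to_ac_poly.hom_mult root_g)
  next
    fix c assume c: "c \<in> code A"
    define u where "u = (\<Sum>i<n. monom (c $ i) i)"
    have coeff_u: "coeff u i = (if i < n then c $ i else 0)" for i
      by (simp add: u_def coeff_sum)
    have c_eq: "c = vec n (coeff u)"
      using c by (intro eq_vecI) (auto simp: code_def coeff_u)
    have "poly (map_poly to_ac u) (\<alpha> powi t) = 0" if "t \<in> A" for t
      using c that spectrum_vec_coeff[of u t] by (simp add: code_def coeff_u flip: c_eq)
    moreover have "map_poly to_ac u =
        map_poly to_ac g * map_poly to_ac (u div g) + map_poly to_ac (u mod g)"
      by (simp flip: to_ac_poly.hom_mult to_ac_poly.hom_add)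
    ultimately have root: "poly (map_poly to_ac (u mod g)) (\<alpha> powi t) = 0" if "t \<in> A" for t
      using that root_g by simp
    \<comment> \<open>A nonzero remainder would have degree below \<open>card A\<close> but
      \<open>card A\<close> distinct roots.\<close>
    have "u mod g = 0"
    proof (rule ccontr)
      assume nz: "u mod g \<noteq> 0"
      then have nz': "map_poly to_ac (u mod g) \<noteq> 0" by simp
      have "(\<lambda>t. \<alpha> powi t) ` A \<subseteq> {x. poly (map_poly to_ac (u mod g)) x = 0}"
        using root by blast
      then have "card ((\<lambda>t. \<alpha> powi t) ` A) \<le> degree (map_poly to_ac (u mod g))"
        using card_poly_roots_bound[OF nz'] poly_roots_finite[OF nz'] card_mono order.trans by meson
      moreover have "card ((\<lambda>t. \<alpha> powi t) ` A) = card A"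
        using inj_on_subset[OF inj_on_alpha_powi frob_closed_subset[OF A]] by (rule card_image)
      moreover have "degree (u mod g) < degree g" using degree_mod_less'[OF g0 nz] .
      ultimately show False using deg_g by simp
    qed
    then have u: "g * (u div g) = u" by (metis add.right_neutral mult_div_mod_eq)
    then have "u div g \<in> P" unfolding bounded by (simp add: coeff_u)
    then show "c \<in> (\<lambda>v. vec n (coeff (g * v))) ` P"
      using u c_eq by (metis image_eqI)
  qed
  moreover have "card P = q ^ d" "finite P"
    using card_polys_below[where 'a = 'a, of d] by (simp_all add: P_def q_eq)
  ultimately show "card (code A) = q ^ (n - card A)" "finite (code A)"
    by (auto simp: d_def bij_betw_same_card bij_betw_finite dest: bij_betw_same_card)
qed

text \<open>Parseval's identity: after expanding and summing over \<open>t\<close> first,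
  \<open>alpha_orthogonality\<close> leaves only the terms with \<open>j = i\<close>.\<close>

lemma sum_spectrum_mult:
  assumes "c \<in> carrier_vec n" "d \<in> carrier_vec n"
  shows "(\<Sum>t<n. spectrum c (int t) * spectrum d (- int t)) = of_nat n * to_ac (c \<bullet> d)"
proof -
  have "(\<Sum>t<n. spectrum c (int t) * spectrum d (- int t)) =
      (\<Sum>t<n. \<Sum>i<n. \<Sum>j<n. to_ac (c $ i) * to_ac (d $ j) * (\<alpha> powi (int i - int j)) ^ t)"
  proof (intro sum.cong refl)
    fix t
    have "\<alpha> powi (int t * int i) * \<alpha> powi (- int t * int j) = (\<alpha> powi (int i - int j)) ^ t" for i j
    proof -
      have "\<alpha> powi (int t * int i) * \<alpha> powi (- int t * int j) =
          \<alpha> powi (int t * int i + - int t * int j)"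
        by (simp only: power_int_add alpha_nonzero simp_thms)
      also have "int t * int i + - int t * int j = (int i - int j) * int t"
        by (simp add: algebra_simps)
      finally show ?thesis by (simp only: power_int_mult power_int_of_nat)
    qed
    then show "spectrum c (int t) * spectrum d (- int t) =
      (\<Sum>i<n. \<Sum>j<n. to_ac (c $ i) * to_ac (d $ j) * (\<alpha> powi (int i - int j)) ^ t)"
      unfolding spectrum_def sum_product by (simp add: mult_ac)
  qed
  also have "\<dots> = (\<Sum>i<n. \<Sum>j<n. \<Sum>t<n. to_ac (c $ i) * to_ac (d $ j) * (\<alpha> powi (int i - int j)) ^ t)"
    by (subst sum.swap, rule sum.cong, rule refl, rule sum.swap)
  also have "\<dots> = (\<Sum>i<n. \<Sum>j<n. if j = i then to_ac (c $ i) * to_ac (d $ j) * of_nat n else 0)"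
  proof (intro sum.cong refl)
    fix i j assume "i \<in> {..<n}" "j \<in> {..<n}"
    then have "int n dvd int i - int j \<longleftrightarrow> j = i"
      by (metis cong_iff_dvd_diff cong_int_iff cong_less_modulus_unique_nat lessThan_iff cong_refl)
    then show "(\<Sum>t<n. to_ac (c $ i) * to_ac (d $ j) * (\<alpha> powi (int i - int j)) ^ t) =
        (if j = i then to_ac (c $ i) * to_ac (d $ j) * of_nat n else 0)"
      by (simp add: alpha_orthogonality flip: sum_distrib_left)
  qed
  also have "\<dots> = of_nat n * to_ac (c \<bullet> d)"
    using assms by (simp add: scalar_prod_def to_ac_sum sum_distrib_left mult_ac atLeast0LessThan)
  finally show ?thesis .
qed

end

section \<open>The dual of a cyclic code and the BCH bound\<close>

context bch_root
begin

lemma alpha_powi_power_q_m: "(\<alpha> powi i) ^ (q ^ m) = \<alpha> powi i"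
proof -
  have "(\<alpha> powi i) ^ (q ^ m) = \<alpha> powi (i * int q ^ m)"
    by (simp add: power_int_mult flip: power_int_of_nat)
  also have "\<dots> = \<alpha> powi i"
    using cong_mult_q_power_m[of i] alpha_powi_mod by (metis cong_def)
  finally show ?thesis .
qed

text \<open>Raising to the power \<open>q\<close> permutes the summands cyclically, so the sum is
  fixed.\<close>

lemma trace_in_range_to_ac:
  fixes y :: "'a alg_closure"
  assumes "y ^ (q ^ m) = y"
  shows "(\<Sum>l<m. y ^ (q ^ l)) \<in> range to_ac"
proof -
  have "(\<Sum>l<m. y ^ (q ^ l)) ^ q = (\<Sum>l<m. y ^ (q ^ Suc l))"
    using sum_power_q[of "\<lambda>l. y ^ (q ^ l)" "{..<m}" 1] by (simp add: mult.commute flip: power_mult)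
  also have "\<dots> = (\<Sum>l<m. y ^ (q ^ l))"
    using sum.lessThan_Suc_shift[of "\<lambda>l. y ^ (q ^ l)" m] assms by (simp add: add.commute)
  finally show ?thesis by (simp add: range_to_ac_iff)
qed

text \<open>A word of the dual is tested against the words
  \<open>Tr (\<alpha>\<^sup>j \<alpha>\<^sup>t\<^sup>i)\<close>, \<open>i < n\<close>, where \<open>Tr\<close> is the trace from the field of \<open>q\<^sup>m\<close> elements. Their
  spectrum is supported on the coset of \<open>- t\<close>, and nondegeneracy of \<open>Tr\<close> isolates the coefficient
  at \<open>t\<close>.\<close>

lemma spectrum_dual_eq_0:
  assumes A: "frob_closed A" and d: "d \<in> euclidean_dual n (code A)"
    and t: "t \<in> {0..<int n}" "t \<notin> neg_residues n A"
  shows "spectrum d t = 0"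
proof (rule ccontr)
  assume nz: "spectrum d t \<noteq> 0"
  \<comment> \<open>Because \<open>spectrum d t\<close> is nonzero, its \<open>n\<close> multiples
    by powers of \<alpha> are distinct; that exceeds the degree q^(m-1) of the trace
    polynomial.\<close>
  have "\<exists>x\<in>(\<lambda>j. \<alpha> powi j * spectrum d t) ` {0..<int n}. (\<Sum>l<m. x ^ (q ^ l)) \<noteq> 0"
  proof (rule trace_polynomial_nonzero)
    have "inj_on (\<lambda>j. \<alpha> powi j * spectrum d t) {0..<int n}"
      using inj_on_alpha_powi nz by (simp add: inj_on_def)
    then have "card ((\<lambda>j. \<alpha> powi j * spectrum d t) ` {0..<int n}) = n"
      by (simp add: card_image)
    moreover have "q ^ (m - 1) < n"
    proof -
      have "q ^ 1 \<le> q ^ (m - 1)" using q_ge_2 m_ge_2 by (intro power_increasing) auto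
      moreover have "q * q ^ (m - 1) = n + 1"
        using q_power_m m_ge_2 by (metis Suc_1 Suc_diff_1 less_le_trans pos2 power_Suc)
      moreover have "2 * q ^ (m - 1) \<le> q * q ^ (m - 1)" using q_ge_2 by simp
      ultimately show ?thesis using q_ge_2 by simp
    qed
    ultimately show "q ^ (m - 1) < card ((\<lambda>j. \<alpha> powi j * spectrum d t) ` {0..<int n})" by simp
  qed (use q_ge_2 m_ge_2 in auto)
  then obtain j where j: "(\<Sum>l<m. (\<alpha> powi j * spectrum d t) ^ (q ^ l)) \<noteq> 0" by blast
  define y where "y i = \<alpha> powi (j + t * int i)" for i
  \<comment> \<open>Applying \<open>of_ac\<close> is legitimate since the trace lies in the base
    field by \<open>trace_in_range_to_ac\<close>.\<close>
  define c where "c = vec n (\<lambda>i. of_ac (\<Sum>l<m. y i ^ (q ^ l)))"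
  have c_carrier: "c \<in> carrier_vec n" by (simp add: c_def)
  have c_index: "to_ac (c $ i) = (\<Sum>l<m. y i ^ (q ^ l))" if "i < n" for i
    using that trace_in_range_to_ac[of "y i"] alpha_powi_power_q_m
    by (simp add: c_def y_def to_ac_of_ac)
  have "spectrum c s = 0" if s: "s \<in> A" for s
  proof -
    \<comment> \<open>At \<open>s\<close> the spectrum of \<open>c\<close> splits into geometric
      sums with ratio \<alpha> to the power \<open>t * int q ^ l + s\<close>. One of them survives
      only if \<open>- t\<close> lies in the coset of \<open>s\<close>, hence in
      \<open>A\<close>.\<close>
    have not_dvd: "\<not> int n dvd t * int q ^ l + s" if "l < m" for l
    proof
      assume "int n dvd t * int q ^ l + s"
      then have "[- s = t * int q ^ l] (mod int n)"
        by (subst cong_sym_eq) (simp add: cong_iff_dvd_diff)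
      then have "[t = - s * int q ^ (m - l)] (mod int n)"
        using that by (intro cong_q_power_swap) auto
      then have "[- t = s * int q ^ (m - l)] (mod int n)"
        using cong_minus_minus_iff[of t "- s * int q ^ (m - l)" "int n"] by simp
      then have "(- t) mod int n \<in> A"
        using frob_closed_power[OF A s] by (simp add: cong_def)
      then show False using t mem_neg_residues_iff[OF frob_closed_subset[OF A]] by blast
    qed
    have monomial: "y i ^ (q ^ l) * \<alpha> powi (s * int i) =
        \<alpha> powi (j * int q ^ l) * (\<alpha> powi (t * int q ^ l + s)) ^ i" for i l
    proof -
      have "y i ^ (q ^ l) * \<alpha> powi (s * int i) =
          \<alpha> powi ((j + t * int i) * int q ^ l + s * int i)"
        by (simp add: y_def power_int_add power_int_mult flip: power_int_of_nat)
      also have "(j + t * int i) * int q ^ l + s * int i =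
          j * int q ^ l + (t * int q ^ l + s) * int i"
        by (simp add: algebra_simps)
      also have "\<alpha> powi \<dots> = \<alpha> powi (j * int q ^ l) * (\<alpha> powi (t * int q ^ l + s)) ^ i"
        by (subst power_int_add) (simp_all only: power_int_mult power_int_of_nat alpha_nonzero simp_thms)
      finally show ?thesis .
    qed
    have "spectrum c s = (\<Sum>i<n. \<Sum>l<m. y i ^ (q ^ l) * \<alpha> powi (s * int i))"
      by (simp add: spectrum_def c_index sum_distrib_right)
    also have "\<dots> = (\<Sum>l<m. \<Sum>i<n. \<alpha> powi (j * int q ^ l) * (\<alpha> powi (t * int q ^ l + s)) ^ i)"
      by (subst sum.swap) (simp only: monomial)
    also have "\<dots> = (\<Sum>l<m. \<alpha> powi (j * int q ^ l) * (\<Sum>i<n. (\<alpha> powi (t * int q ^ l + s)) ^ i))"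
      by (simp only: sum_distrib_left)
    also have "\<dots> = 0"
      by (intro sum.neutral) (simp add: alpha_orthogonality not_dvd)
    finally show ?thesis .
  qed
  then have "c \<in> code A" using c_carrier by (simp add: code_def)
  then have "to_ac (c \<bullet> d) = 0" using d by (simp add: euclidean_dual_def)
  also have "to_ac (c \<bullet> d) = (\<Sum>i<n. to_ac (c $ i) * to_ac (d $ i))"
    using d by (auto simp: euclidean_dual_def scalar_prod_def to_ac_sum atLeast0LessThan)
  \<comment> \<open>The entries of \<open>d\<close> are fixed by x to x^q, so they may be moved
    inside the powers; the sum over \<open>i\<close> then becomes the spectrum of
    \<open>d\<close>.\<close>
  also have "\<dots> = (\<Sum>i<n. \<Sum>l<m. (\<alpha> powi j * (to_ac (d $ i) * \<alpha> powi (t * int i))) ^ (q ^ l))"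
    by (intro sum.cong refl)
      (simp add: c_index sum_distrib_left y_def power_int_add power_mult_distrib mult_ac)
  also have "\<dots> = (\<Sum>l<m. (\<Sum>i<n. \<alpha> powi j * (to_ac (d $ i) * \<alpha> powi (t * int i))) ^ (q ^ l))"
    by (subst sum.swap) (simp only: sum_power_q)
  also have "\<dots> = (\<Sum>l<m. (\<alpha> powi j * spectrum d t) ^ (q ^ l))"
    by (simp only: spectrum_def sum_distrib_left)
  finally show False using j by simp
qed

text \<open>In Parseval's sum each term has a factor that vanishes: the spectrum of \<open>c\<close>
  at \<open>t\<close> if \<open>t\<close> is in \<open>A\<close>, that of \<open>d\<close> at
  \<open>- t\<close> otherwise. This gives one inclusion; the other is
  \<open>spectrum_dual_eq_0\<close>.\<close>

lemma euclidean_dual_code: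
  assumes A: "frob_closed A"
  shows "euclidean_dual n (code A) = code ({0..<int n} - neg_residues n A)"
proof (intro equalityI subsetI)
  fix d assume d: "d \<in> code ({0..<int n} - neg_residues n A)"
  have "c \<bullet> d = 0" if c: "c \<in> code A" for c
  proof -
    have "spectrum c (int t) * spectrum d (- int t) = 0" if "t < n" for t
    proof (cases "int t \<in> A")
      case True
      then show ?thesis using c by (simp add: code_def)
    next
      case False
      then have "(- int t) mod int n \<in> {0..<int n} - neg_residues n A"
        using that by (simp add: mem_neg_residues_iff[OF frob_closed_subset[OF A]] mod_minus_eq)
      then have "spectrum d ((- int t) mod int n) = 0" using d unfolding code_def by blast
      then show ?thesis by (simp only: spectrum_mod mult_zero_right)
    qed
    then have "(\<Sum>t<n. spectrum c (int t) * spectrum d (- int t)) = 0"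
      by (intro sum.neutral) auto
    then have "of_nat n * to_ac (c \<bullet> d) = 0"
      using c d by (subst (asm) sum_spectrum_mult) (simp_all add: code_def)
    then show ?thesis using of_nat_n_nonzero by simp
  qed
  then show "d \<in> euclidean_dual n (code A)" using d by (simp add: euclidean_dual_def code_def)
qed (auto simp: code_def spectrum_dual_eq_0[OF A], auto simp: euclidean_dual_def)

text \<open>Let \<open>Q\<close> vanish at \<alpha>^i for every support position \<open>i\<close>
  but one, \<open>i0\<close>. If the weight were below \<delta>, then weighting the vanishing
  spectrum values at 1, ..., \<open>card S\<close> by the coefficients of \<open>Q\<close> would
  isolate the nonzero term at \<open>i0\<close>.\<close>

lemma bch_bound:
  assumes c: "c \<in> code {1..int \<delta> - 1}" "c \<noteq> 0\<^sub>v n"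
  shows "\<delta> \<le> card {i. i < n \<and> c $ i \<noteq> 0}"
proof (rule ccontr)
  define S where "S = {i. i < n \<and> c $ i \<noteq> 0}"
  have finS: "finite S" by (simp add: S_def)
  assume "\<not> ?thesis"
  then have small: "card S < \<delta>" by (simp add: S_def)
  obtain i0 where i0: "i0 \<in> S"
    using c by (force simp: S_def code_def intro: eq_vecI)
  define Q where "Q = (\<Prod>i\<in>S - {i0}. [:- (\<alpha> ^ i), 1:])"
  have "degree Q = (\<Sum>i\<in>S - {i0}. degree [:- (\<alpha> ^ i), 1:])"
    unfolding Q_def by (rule degree_prod_eq_sum_degree) simp
  then have deg: "degree Q = card S - 1" using i0 finS by simp
  \<comment> \<open>The extra factor \<alpha>^i shifts exponent \<open>k\<close> to
    \<open>Suc k\<close>, since the prescribed zeros begin at 1 and not at 0.\<close>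
  have "(\<Sum>i<n. to_ac (c $ i) * \<alpha> ^ i * poly Q (\<alpha> ^ i)) =
      (\<Sum>i<n. \<Sum>k\<le>degree Q. coeff Q k * (to_ac (c $ i) * \<alpha> powi (int (Suc k) * int i)))"
  proof (intro sum.cong refl)
    fix i
    have "\<alpha> powi (int (Suc k) * int i) = \<alpha> ^ i * (\<alpha> ^ i) ^ k" for k
      by (metis mult.commute of_nat_mult power_int_of_nat power_Suc power_mult)
    then show "to_ac (c $ i) * \<alpha> ^ i * poly Q (\<alpha> ^ i) =
        (\<Sum>k\<le>degree Q. coeff Q k * (to_ac (c $ i) * \<alpha> powi (int (Suc k) * int i)))"
      by (simp only: poly_altdef sum_distrib_left) (simp only: mult_ac)
  qed
  also have "\<dots> = (\<Sum>k\<le>degree Q. coeff Q k * spectrum c (int (Suc k)))"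
    by (subst sum.swap) (simp only: spectrum_def sum_distrib_left)
  also have "\<dots> = 0"
  proof (intro sum.neutral ballI)
    fix k assume "k \<in> {..degree Q}"
    moreover have "0 < card S" using i0 finS by (simp add: card_gt_0_iff) blast
    ultimately have "int (Suc k) \<in> {1..int \<delta> - 1}" using small deg by simp
    then show "coeff Q k * spectrum c (int (Suc k)) = 0"
      using c(1) unfolding code_def by simp
  qed
  finally have "(\<Sum>i<n. to_ac (c $ i) * \<alpha> ^ i * poly Q (\<alpha> ^ i)) = 0" .
  moreover have "(\<Sum>i<n. to_ac (c $ i) * \<alpha> ^ i * poly Q (\<alpha> ^ i)) =
      (\<Sum>i\<in>{i0}. to_ac (c $ i) * \<alpha> ^ i * poly Q (\<alpha> ^ i))"
  proof (rule sum.mono_neutral_right)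
    show "\<forall>i\<in>{..<n} - {i0}. to_ac (c $ i) * \<alpha> ^ i * poly Q (\<alpha> ^ i) = 0"
    proof
      fix i assume i: "i \<in> {..<n} - {i0}"
      show "to_ac (c $ i) * \<alpha> ^ i * poly Q (\<alpha> ^ i) = 0"
      proof (cases "c $ i = 0")
        case False
        then have "i \<in> S - {i0}" using i by (simp add: S_def)
        then have "poly Q (\<alpha> ^ i) = 0" using finS by (auto simp: Q_def poly_prod)
        then show ?thesis by simp
      qed simp
    qed
  qed (use i0 in \<open>auto simp: S_def\<close>)
  moreover have "poly Q (\<alpha> ^ i0) \<noteq> 0"
  proof -
    have "\<alpha> ^ i0 \<noteq> \<alpha> ^ i" if "i \<in> S - {i0}" for i
    proof
      assume "\<alpha> ^ i0 = \<alpha> ^ i"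
      then have "int i0 = int i"
        using that i0 by (intro inj_onD[OF inj_on_alpha_powi]) (auto simp: S_def)
      then show False using that by simp
    qed
    then show ?thesis using finS by (auto simp: Q_def poly_prod)
  qed
  ultimately show False using i0 by (auto simp: S_def)
qed

end

section \<open>From trace-symplectic to Euclidean duality\<close>

lemma absolute_trace_nonzero: "\<exists>x :: 'a::finite_field. absolute_trace x \<noteq> 0"
proof -
  obtain e where e: "CARD('a) = CHAR('a) ^ e" using card_finite_field_power_CHAR by blast
  have p: "prime CHAR('a)" by (rule prime_CHAR_finite_field)
  have "card {0, 1 :: 'a} \<le> CARD('a)" by (intro card_mono) auto
  then have "e \<noteq> 0" using e by (cases e) auto
  moreover have "multiplicity CHAR('a) CARD('a) = e"
    using p by (simp add: e multiplicity_same_power not_prime_0 not_prime_unit)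
  \<comment> \<open>The whole field has more elements than the degree of its trace
    polynomial.\<close>
  moreover have "CHAR('a) ^ (e - 1) < card (UNIV :: 'a set)"
    using \<open>e \<noteq> 0\<close> prime_gt_1_nat[OF p] by (simp add: e)
  ultimately show ?thesis
    using trace_polynomial_nonzero[of "CHAR('a)" e "UNIV :: 'a set"] prime_ge_2_nat[OF p]
    by (simp add: absolute_trace_def)
qed

text \<open>Putting 0 in one component separates the two conditions. A nonzero inner product with a
  word of \<open>C\<close> could be scaled to any field element, in particular to one of nonzero
  trace; so vanishing traces force vanishing inner products.\<close>

lemma trace_symplectic_dual_Times:
  fixes C :: "'a::finite_field vec set"
  assumes C: "C \<subseteq> carrier_vec n" "0\<^sub>v n \<in> C" "\<And>a c. c \<in> C \<Longrightarrow> a \<cdot>\<^sub>v c \<in> C"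
  shows "trace_symplectic_dual n (C \<times> C) = euclidean_dual n C \<times> euclidean_dual n C"
proof (intro equalityI subsetI)
  fix v assume v: "v \<in> trace_symplectic_dual n (C \<times> C)"
  obtain x y where xy: "v = (x, y)" "x \<in> carrier_vec n" "y \<in> carrier_vec n"
    using v by (auto simp: trace_symplectic_dual_def)
  have orth: "absolute_trace (x \<bullet> b - a \<bullet> y) = 0" if "a \<in> C" "b \<in> C" for a b
    using v that by (auto simp: trace_symplectic_dual_def xy)
  obtain w :: 'a where w: "absolute_trace w \<noteq> 0" using absolute_trace_nonzero by blast
  have "c \<bullet> x = 0" if c: "c \<in> C" for c
  proof (rule ccontr)
    assume nz: "c \<bullet> x \<noteq> 0"
    have "x \<bullet> c = c \<bullet> x" using C(1) c xy by (intro comm_scalar_prod[of _ n]) auto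
    then have "x \<bullet> ((w / (c \<bullet> x)) \<cdot>\<^sub>v c) - 0\<^sub>v n \<bullet> y = w"
      using C(1) c xy nz by (subst scalar_prod_smult_distrib[of _ n]) auto
    then show False using orth[OF C(2) C(3)[OF c]] w by metis
  qed
  moreover have "c \<bullet> y = 0" if c: "c \<in> C" for c
  proof (rule ccontr)
    assume nz: "c \<bullet> y \<noteq> 0"
    then have "x \<bullet> 0\<^sub>v n - ((- w / (c \<bullet> y)) \<cdot>\<^sub>v c) \<bullet> y = w"
      using C(1) c xy by (subst smult_scalar_prod_distrib[of _ n]) auto
    then show False using orth[OF C(3)[OF c] C(2)] w by metis
  qed
  ultimately show "v \<in> euclidean_dual n C \<times> euclidean_dual n C"
    using xy by (simp add: euclidean_dual_def)
next
  fix v assume v: "v \<in> euclidean_dual n C \<times> euclidean_dual n C"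
  obtain x y where xy: "v = (x, y)" "x \<in> euclidean_dual n C" "y \<in> euclidean_dual n C"
    using v by auto
  have "x \<bullet> b - a \<bullet> y = 0" if "a \<in> C" "b \<in> C" for a b
    using xy that C(1) comm_scalar_prod[of x n b] by (auto simp: euclidean_dual_def)
  moreover have "absolute_trace 0 = (0 :: 'a)"
    using prime_gt_0_nat[OF prime_CHAR_finite_field[where 'a = 'a]]
    by (simp add: absolute_trace_def power_0_left)
  ultimately show "v \<in> trace_symplectic_dual n (C \<times> C)"
    using xy by (auto simp: trace_symplectic_dual_def euclidean_dual_def)
qed


section \<open>Subsystem codes\<close>

text \<open>Inverses are obtained from closure under the scalar \<open>- 1\<close>.\<close>

lemma subgroup_Times_vec:
  fixes C :: "'a::field vec set"
  assumes "C \<subseteq> carrier_vec n" "0\<^sub>v n \<in> C"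
    "\<And>c d. c \<in> C \<Longrightarrow> d \<in> C \<Longrightarrow> c + d \<in> C" "\<And>a c. c \<in> C \<Longrightarrow> a \<cdot>\<^sub>v c \<in> C"
  shows "subgroup (C \<times> C) (monoid_vec TYPE('a) n \<times>\<times> monoid_vec TYPE('a) n)"
proof -
  interpret V: comm_group "monoid_vec TYPE('a) n" by (rule comm_group_vec)
  have "subgroup C (monoid_vec TYPE('a) n)"
  proof (rule V.subgroupI)
    fix c assume c: "c \<in> C"
    then have "c \<in> carrier_vec n" using assms(1) by blast
    then have "inv\<^bsub>monoid_vec TYPE('a) n\<^esub> c = (- 1) \<cdot>\<^sub>v c"
      by (intro V.inv_equality) (auto simp: monoid_vec_simps intro!: eq_vecI)
    then show "inv\<^bsub>monoid_vec TYPE('a) n\<^esub> c \<in> C" using assms(4) c by simp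
  qed (use assms in \<open>auto simp: monoid_vec_simps\<close>)
  then show ?thesis
    using V.group_axioms by (intro DirProd_subgroups)
qed

section \<open>Distance and parameters of the constructed code\<close>

context bch_root
begin

text \<open>The symplectic weight is at least the Hamming weight of either component, and a nonzero
  component is subject to \<open>bch_bound\<close>.\<close>

lemma swt_ge:
  assumes "bch_defining_set q n \<delta> \<subseteq> A" "x \<in> code A" "y \<in> code A" "(x, y) \<noteq> (0\<^sub>v n, 0\<^sub>v n)"
  shows "\<delta> \<le> swt (x, y)"
proof -
  have "code A \<subseteq> code {1..int \<delta> - 1}"
  proof
    fix c assume c: "c \<in> code A"
    have "spectrum c t = 0" if "t \<in> {1..int \<delta> - 1}" for t
    proof -
      have "t mod int n \<in> cyclotomic_coset q n t"
        by (auto simp: cyclotomic_coset_def intro: exI[of _ 0])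
      then have "t mod int n \<in> A"
        using assms(1) that unfolding bch_defining_set_def by blast
      then show ?thesis using c spectrum_mod[of c t] by (simp add: code_def)
    qed
    then show "c \<in> code {1..int \<delta> - 1}" using c by (simp add: code_def)
  qed
  then have weight: "\<delta> \<le> card {i. i < n \<and> c $ i \<noteq> 0}" if "c \<in> code A" "c \<noteq> 0\<^sub>v n" for c
    using that bch_bound by blast
  have dim: "dim_vec x = n" using assms(2) by (simp add: code_def)
  from assms(4) consider "x \<noteq> 0\<^sub>v n" | "y \<noteq> 0\<^sub>v n" by blast
  then show ?thesis
  proof cases
    case 1
    with weight[OF assms(2)] show ?thesis
      by (auto simp: dim intro!: card_mono elim!: order.trans)
  next
    case 2
    with weight[OF assms(3)] show ?thesis
      by (auto simp: dim intro!: card_mono elim!: order.trans)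
  qed
qed

text \<open>Here \<open>U\<close> is any symmetric set of gauge exponents avoiding \<open>Z\<close>.
  The strict inequality \<open>card\<close> makes the encoded dimension positive, which decides the
  case distinction in the definition of the distance.\<close>

lemma bch_subsystem_code:
  assumes small: "(\<delta> - 1) * (1 + q ^ (m div 2)) < n"
    and Z_def: "Z = bch_defining_set q n \<delta>"
    and U: "frob_closed U" "neg_residues n U = U" "U \<inter> Z = {}"
    and card: "2 * card Z + card U < n"
  shows "subsystem_code_min_dist_ge_exists TYPE('a) n (n - 2 * card Z - card U) (card U) \<delta>"
proof -
  define N where "N = {0..<int n}"
  define Z' where "Z' = neg_residues n Z"
  define A where "A = N - (Z' \<union> U)"
  have Z: "frob_closed Z" unfolding Z_def by (rule frob_closed_bch_defining_set)
  have Z': "frob_closed Z'" unfolding Z'_def using Z by (rule frob_closed_neg_residues)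
  have A: "frob_closed A"
    unfolding A_def N_def by (intro frob_closed_complement frob_closed_Un Z' U)
  have NZ': "frob_closed (N - Z')"
    unfolding N_def by (intro frob_closed_complement Z')
  note subsets = frob_closed_subset[OF Z, folded N_def] frob_closed_subset[OF Z', folded N_def]
    frob_closed_subset[OF U(1), folded N_def]
  have neg_Z': "neg_residues n Z' = Z"
    unfolding Z'_def by (intro neg_residues_neg_residues frob_closed_subset Z)
  have disj: "Z \<inter> Z' = {}"
    unfolding Z'_def Z_def using small by (rule bch_defining_set_neg_disjoint)
  \<comment> \<open>Negating a common element would give an element of both \<open>U\<close> and
    \<open>Z\<close>.\<close>
  have U_Z': "U \<inter> Z' = {}"
  proof (rule ccontr)
    assume "U \<inter> Z' \<noteq> {}"
    then obtain t where t: "t \<in> U" "t \<in> Z'" by blast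
    then have "(- t) mod int n \<in> neg_residues n U" "(- t) mod int n \<in> neg_residues n Z'"
      by (auto simp: neg_residues_def)
    then show False using U neg_Z' by blast
  qed

  have "neg_residues n A = N - (Z \<union> U)"
    unfolding A_def N_def using subsets
    by (subst neg_residues_Diff) (auto simp: N_def neg_residues_Un neg_Z' U(2))
  then have "N - neg_residues n A = Z \<union> U" using subsets by auto
  then have dual_A: "euclidean_dual n (code A) = code (Z \<union> U)"
    using euclidean_dual_code[OF A] by (simp add: N_def)
  \<comment> \<open>Intersecting codes unites their zeros, so this is the defining set of either
    component of Y.\<close>
  have A_Un: "A \<union> (Z \<union> U) = N - Z'"
    using subsets disj U_Z' by (auto simp: A_def)
  have "N - neg_residues n (N - Z') = Z"
    unfolding N_def using subsets
    by (subst neg_residues_Diff) (auto simp: N_def neg_Z')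
  then have dual_NZ': "euclidean_dual n (code (N - Z')) = code Z"
    using euclidean_dual_code[OF NZ'] by (simp add: N_def)

  define S where "S = code A \<times> code A"
  have code_carrier: "code B \<subseteq> carrier_vec n" for B by (auto simp: code_def)
  have dual_Times: "trace_symplectic_dual n (code B \<times> code B) =
      euclidean_dual n (code B) \<times> euclidean_dual n (code B)" for B
    by (intro trace_symplectic_dual_Times code_carrier zero_in_code smult_in_code)
  have Y: "S \<inter> trace_symplectic_dual n S = code (N - Z') \<times> code (N - Z')"
    unfolding S_def dual_Times dual_A by (simp add: Times_Int_Times code_Int A_Un)
  have Yd: "trace_symplectic_dual n (S \<inter> trace_symplectic_dual n S) = code Z \<times> code Z"
    unfolding Y dual_Times dual_NZ' ..

  have finU: "finite U" "finite Z" "finite Z'"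
    using U(1) Z Z' by (auto intro: frob_closed_finite)
  have card_Z': "card Z' = card Z"
    unfolding Z'_def by (intro card_neg_residues frob_closed_subset Z)
  have card_A: "n - card A = card Z + card U"
  proof -
    have "card (Z' \<union> U) = card Z + card U"
      using U_Z' finU by (subst card_Un_disjoint) (auto simp: card_Z')
    moreover have "card A = card N - card (Z' \<union> U)"
      unfolding A_def using finU subsets by (intro card_Diff_subset) auto
    ultimately show ?thesis using card by (simp add: N_def)
  qed
  have card_NZ': "n - card (N - Z') = card Z"
    using finU subsets card by (subst card_Diff_subset) (auto simp: card_Z' N_def)
  have card_S: "card S = q ^ (2 * (card Z + card U))"
    by (simp add: S_def card_cartesian_product card_code[OF A] card_A mult_2 power_add)
  have card_Y: "card (code (N - Z') \<times> code (N - Z')) = q ^ (2 * card Z)"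
    by (simp add: card_cartesian_product card_code[OF NZ'] card_NZ' mult_2 power_add)
  define k where "k = n - 2 * card Z - card U"
  have n_split: "n = k + 2 * card Z + card U" using card by (simp add: k_def)
  have q0: "real q \<noteq> 0" using q_ge_2 by simp

  \<comment> \<open>The exponents are \<open>card Z + card U\<close> and \<open>n - card Z\<close>,
    so \<open>card\<close> gives strictness. Hence the dual of Y differs from \<open>S\<close>, and
    the first branch of the distance applies.\<close>
  have "card (code A) < card (code Z)"
    using card q_ge_2 card_A card_code[OF A] card_code[OF Z] by (simp add: power_strict_increasing)
  then have neq: "code Z \<times> code Z \<noteq> S"
    using card_code(1)[OF A] q_ge_2 by (auto simp: S_def times_eq_iff)
  have "Z \<subseteq> A" using subsets disj U(3) by (auto simp: A_def)
  then have "S \<subseteq> code Z \<times> code Z" unfolding S_def using code_mono by blast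
  \<comment> \<open>\<open>Min\<close> has to range over a nonempty set. As zero lies in
    \<open>S\<close>, discarding it from the difference loses nothing.\<close>
  with neq have "code Z \<times> code Z - S \<noteq> {}" by blast
  moreover have "(0\<^sub>v n, 0\<^sub>v n) \<in> S" by (simp add: S_def zero_in_code)
  ultimately have nonempty: "code Z \<times> code Z - S - {(0\<^sub>v n, 0\<^sub>v n)} \<noteq> {}" by auto
  have "\<delta> \<le> swt_set n (code Z \<times> code Z - S)"
    unfolding swt_set_def
  proof (subst Min_ge_iff)
    show "\<forall>w\<in>swt ` (code Z \<times> code Z - S - {(0\<^sub>v n, 0\<^sub>v n)}). \<delta> \<le> w"
      using swt_ge[of \<delta> Z] by (auto simp: Z_def simp del: swt.simps)
  qed (use nonempty card_code(2)[OF Z] in auto)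
  moreover have "subsystem_code_exists TYPE('a) n (q ^ k) (q ^ card U) (swt_set n (code Z \<times> code Z - S))"
    unfolding subsystem_code_exists_def Let_def
  proof (intro exI[of _ S] conjI)
    show "subgroup S (monoid_vec TYPE('a) n \<times>\<times> monoid_vec TYPE('a) n)"
      unfolding S_def
      by (intro subgroup_Times_vec code_carrier zero_in_code add_in_code smult_in_code)
    have "real q ^ n * real q ^ card U = real q ^ (2 * (card Z + card U)) * real q ^ k"
      by (subst n_split) (simp add: algebra_simps flip: power_add)
    then show "real (card S) = real CARD('a) ^ n * real (q ^ card U) / real (q ^ k)"
      using q0 by (simp add: card_S q_eq[symmetric] field_simps)
    have "real q ^ n = real q ^ (2 * card Z) * (real q ^ k * real q ^ card U)"
      by (subst n_split) (simp add: algebra_simps flip: power_add)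
    then show "real (card (S \<inter> trace_symplectic_dual n S)) =
        real CARD('a) ^ n / (real (q ^ k) * real (q ^ card U))"
      using q0 by (simp add: Y card_Y q_eq[symmetric] field_simps)
  qed (use Yd neq in simp)
  ultimately show ?thesis
    unfolding subsystem_code_min_dist_ge_exists_def k_def[symmetric] q_eq[symmetric] by blast
qed

end

section \<open>Arithmetic of the designed distance, and assembly of the result\<close>

lemma nat_ceiling_diff_div:
  fixes D q :: nat
  assumes "0 < q"
  shows "nat \<lceil>real D * (1 - 1 / real q)\<rceil> = D - D div q"
proof -
  have "real D * (1 - 1 / real q) = of_int (int D) - real D / real q"
    using assms by (simp add: field_simps)
  also have "\<lceil>\<dots>\<rceil> = int D - \<lfloor>real D / real q\<rfloor>" by linarith
  also have "\<lfloor>real D / real q\<rfloor> = int (D div q)" by (rule floor_divide_of_nat_eq)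
  finally show ?thesis by simp
qed

text \<open>With h = m div 2 and Q = q^h, the range gives \<delta> - 1 <= Q - 2 for even
  \<open>m\<close> and \<delta> - 1 <= qQ - q for odd \<open>m\<close>. Multiplying by 1 + Q yields
  at most Q^2 - Q - 2 and qQ^2 - q, both below q^m - 1.\<close>

lemma designed_distance_small:
  assumes "2 \<le> q" "2 \<le> m" "2 \<le> \<delta>"
    and bound: "int \<delta> \<le> int q ^ nat \<lceil>real m / 2\<rceil> - 1 - (int q - 2) * of_bool (odd m)"
  shows "(\<delta> - 1) * (1 + q ^ (m div 2)) < q ^ m - 1"
proof -
  define h where "h = m div 2"
  define Q where "Q = int q ^ h"
  have Q: "2 \<le> Q"
  proof -
    have "int q ^ 1 \<le> Q"
      unfolding Q_def using assms by (intro power_increasing) (auto simp: h_def)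
    then show ?thesis using assms(1) by simp
  qed
  have "(int \<delta> - 1) * (1 + Q) < int q ^ m - 1"
  proof (cases "even m")
    case True
    then have m: "m = h + h" by (auto simp: h_def)
    then have h: "nat \<lceil>real m / 2\<rceil> = h" by simp
    have "int \<delta> \<le> Q - 1 - (int q - 2) * of_bool (odd m)"
      using bound by (simp only: h Q_def)
    then have "int \<delta> - 1 \<le> Q - 2" using True by simp
    then have "(int \<delta> - 1) * (1 + Q) \<le> (Q - 2) * (1 + Q)" using Q by (intro mult_right_mono) auto
    also have "\<dots> < int q ^ m - 1" using Q by (simp add: m power_add Q_def[symmetric] algebra_simps)
    finally show ?thesis .
  next
    case False
    then have m: "m = Suc (h + h)" by (metis add.commute h_def mult_2 odd_two_times_div_two_succ plus_1_eq_Suc)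
    have "\<lceil>real m / 2\<rceil> = int (Suc h)" 
      by (rule ceiling_unique) (simp_all add: m)
    then have h: "nat \<lceil>real m / 2\<rceil> = Suc h" by simp
    have "int \<delta> \<le> int q * Q - 1 - (int q - 2) * of_bool (odd m)"
      using bound by (simp only: h Q_def power_Suc)
    then have "int \<delta> - 1 \<le> int q * Q - int q" using False by simp
    then have "(int \<delta> - 1) * (1 + Q) \<le> (int q * Q - int q) * (1 + Q)"
      using Q by (intro mult_right_mono) auto
    also have "\<dots> < int q ^ m - 1"
      using assms(1) by (simp add: m power_add Q_def[symmetric] algebra_simps)
    finally show ?thesis .
  qed
  moreover have "int ((\<delta> - 1) * (1 + q ^ (m div 2))) = (int \<delta> - 1) * (1 + Q)"
  proof -
    have "int \<delta> - 1 = int (\<delta> - 1)" using assms(3) by simp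
    then show ?thesis
      by (simp only: Q_def h_def of_nat_mult of_nat_add of_nat_1 of_nat_power)
  qed
  moreover have "int (q ^ m - 1) = int q ^ m - 1" using assms(1) by simp
  ultimately show ?thesis by linarith
qed

theorem corollary8:
  fixes q m n \<delta> k r :: nat
    and C :: "'a::finite_field vec set"
    and T :: "int set"
  assumes "q = CARD('a)"
    and "m \<ge> 2"
    and "n = q ^ m - 1"
    and "2 \<le> \<delta>"
    and "int \<delta> \<le> int q ^ nat \<lceil>real m / 2\<rceil> - 1 - (int q - 2) * of_bool (odd m)"
    and "primitive_narrow_sense_bch_code m \<delta> C"
    and "T \<subseteq> {0..<int n} -
           (\<Union>a\<in>{1..int \<delta> - 1}. cyclotomic_coset q n a \<union> cyclotomic_coset q n (- a))"
    and "is_union_of_cosets q n T"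
    and "r = card (T \<union> neg_residues n T)"
    and "k = m * nat \<lceil>(real \<delta> - 1) * (1 - 1 / real q)\<rceil>"
    and "int r < int n - 2 * int k"
  shows "subsystem_code_min_dist_ge_exists TYPE('a)
           (q ^ m - 1)
           (q ^ m - 1 - 2 * m * nat \<lceil>(real \<delta> - 1) * (1 - 1 / real q)\<rceil> - r)
           r \<delta>"
proof -
  \<comment> \<open>The BCH code supplies the primitive root of unity.\<close>
  obtain \<alpha> :: "'a alg_closure" where "primitive_root_of_unity (CARD('a) ^ m - 1) \<alpha>"
    using assms(6) unfolding primitive_narrow_sense_bch_code_def Let_def by blast
  then interpret bch_root \<alpha> q m n
    using assms(1-3) by (simp add: bch_root_def)
  define Z where "Z = bch_defining_set q n \<delta>"
  define U where "U = T \<union> neg_residues n T"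
  have small: "(\<delta> - 1) * (1 + q ^ (m div 2)) < n"
    unfolding assms(3) using q_ge_2 assms by (intro designed_distance_small)
  have real_eq: "real \<delta> - 1 = real (\<delta> - 1)" using assms(4) by simp
  have "0 < q" using q_ge_2 by simp
  \<comment> \<open>The ceiling becomes the number of integers in 1, ..., \<delta> - 1 not divisible
    by \<open>q\<close>, as counted in \<open>card_bch_defining_set\<close>.\<close>
  then have "k = m * ((\<delta> - 1) - (\<delta> - 1) div q)"
    unfolding assms(10) real_eq by (simp only: nat_ceiling_diff_div)
  then have k: "card Z = k"
    unfolding Z_def using card_bch_defining_set[OF small] by simp
  obtain J where J: "T = (\<Union>x\<in>J. cyclotomic_coset q n x)"
    using assms(8) unfolding is_union_of_cosets_def by blast
  have T: "frob_closed T"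
    unfolding J by (intro frob_closed_UN frob_closed_cyclotomic_coset)
  have "frob_closed U"
    unfolding U_def by (intro frob_closed_Un frob_closed_neg_residues T)
  moreover have "neg_residues n U = U"
    using neg_residues_neg_residues[OF frob_closed_subset[OF T]]
    by (auto simp: U_def neg_residues_Un)
  moreover have "U \<inter> Z = {}"
  proof -
    have "neg_residues n Z = (\<Union>a\<in>{1..int \<delta> - 1}. cyclotomic_coset q n (- a))"
      unfolding Z_def bch_defining_set_def neg_residues_cyclotomic_coset[symmetric]
      by (auto simp: neg_residues_def)
    then have TZ: "T \<inter> Z = {}" "T \<inter> neg_residues n Z = {}"
      using assms(7) by (auto simp: Z_def bch_defining_set_def)
    \<comment> \<open>Negation turns an element common to \<open>Z\<close> and the negatives of
      \<open>T\<close> into one common to \<open>T\<close> and the negatives of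
      \<open>Z\<close>.\<close>
    have "t \<notin> Z" if "t \<in> neg_residues n T" for t
    proof
      assume "t \<in> Z"
      then have "(- t) mod int n \<in> neg_residues n Z" by (auto simp: neg_residues_def)
      moreover have "(- t) mod int n \<in> T"
        using that mem_neg_residues_iff[OF frob_closed_subset[OF T]] by blast
      ultimately show False using TZ(2) by blast
    qed
    then show ?thesis using TZ(1) by (auto simp: U_def)
  qed
  ultimately have "subsystem_code_min_dist_ge_exists TYPE('a) n (n - 2 * card Z - card U) (card U) \<delta>"
    using assms(9,11) k by (intro bch_subsystem_code small Z_def) (simp_all add: U_def)
  moreover have "n - 2 * card Z - card U =
      q ^ m - 1 - 2 * m * nat \<lceil>(real \<delta> - 1) * (1 - 1 / real q)\<rceil> - r"
    using assms(3,9,10) k by (simp add: U_def mult.assoc)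
  ultimately show ?thesis using assms(3,9) by (simp add: U_def)
qed

end
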